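(* Suppose there exists a secure public key encryption scheme $(\mathsf{gen},\mathsf{enc},\mathsf{dec})$ that generates $n$-bit encryptions of single-bit messages and whose decryption error is $\epsilon:=\epsilon(n)\le 1/n^{\omega(1)}$. Let $\mu$ be the distribution over decryption functions $\mathsf{dec}(\mathsf{sk},\cdot)$ (with $\mathsf{sk}$ hard-wired) where $(\mathsf{sk},\mathsf{pk})\sim\mathsf{gen}$. If for every $\mathsf{sk}$, $\mathsf{dec}(\mathsf{sk},\cdot)\in\Lambda$, then $(\Lambda,\mu)$ is not efficiently distributionally PAC-learnable.
   Context: A public key encryption scheme with security parameter $n$: $\mathsf{gen}$ is a probabilistic polynomial-time algorithm outputting a key pair $(\mathsf{sk},\mathsf{pk})$; $\mathsf{enc}(\mathsf{pk},y)$ is a probabilistic polynomial-time algorithm mapping $y\in\{0,1\}$ to a ciphertext in $\{0,1\}^n$; $\mathsf{dec}(\mathsf{sk},\cdot)$ maps ciphertexts to bits. Decryption error $\epsilon$ means $\Pr[\mathsf{dec}(\mathsf{sk},\mathsf{enc}(\mathsf{pk},y))\ne y]\le\epsilon$. Security means that for every probabilistic polynomial-time $D$, $|\Pr[D(\mathsf{pk},\mathsf{enc}(\mathsf{pk},1))=1]-\Pr[D(\mathsf{pk},\mathsf{enc}(\mathsf{pk},0))=1]|$ is smaller than $1/p(n)$ for every polynomial $p$ and all large $n$. $\Lambda$ is a class of Boolean functions on $\{0,1\}^n$. For a class $\Lambda$ and a distribution $\mu$ over functions in $\Lambda$, $(\Lambda,\mu)$ is efficiently distributionally PAC-learnable if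 there is an algorithm $A$ running in time $\mathrm{poly}(n,\epsilon^{-1},\delta^{-1},\eta^{-1})$ such that for all $n,\epsilon,\delta,\eta>0$: $\Pr_{f\sim\mu}[\Pr_A[\forall\rho: \Pr_{x\sim\rho}[h(x)\ne f(x)]\le\epsilon,\ h\leftarrow A^{\mathrm{EX}(f,\rho)}(n,\epsilon,\delta,\eta)]\ge1-\delta]\ge1-\eta$, where $\rho$ ranges over distributions on $\{0,1\}^n$ and $\mathrm{EX}(f,\rho)$ returns independent labelled examples $\langle x,f(x)\rangle$ with $x\sim\rho$. *)

theory Defs
  imports "HOL-Probability.Probability" "HOL-Computational_Algebra.Polynomial"
begin

section \<open>Probabilistic algorithms\<close>

text \<open>
  Algorithms are structured programs over finitely many stacks of bits, i.e. multi-tape Turing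
  machines (two stacks per tape) with coin tossing and, for learners, access to random labelled examples.
  Each instruction takes one step. In a step the maximal stack height grows by at most one (or
  becomes the length of an example), so \<^verbatim>\<open>Copy\<close> and \<^verbatim>\<open>Sample\<close> at unit cost change running times
  only polynomially with respect to Turing machines.
\<close>

datatype instr =
    Push bool nat
  | Pop nat
  | Copy nat nat  \<comment> \<open>target, source\<close>
  | Flip nat
  | Sample nat nat  \<comment> \<open>targets for the instance and the label of an example\<close>
  | Branch nat "instr list" "instr list" "instr list"
      \<comment> \<open>cases: stack empty, top bit 0, top bit 1\<close>
  | While nat "instr list"  \<comment> \<open>loop while the stack is nonempty\<close>

type_synonym prog = "instr list"
type_synonym state = "nat \<Rightarrow> bool list"
type_synonym example_source = "(bool list \<times> bool) pmf"

text \<open>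
  A configuration consists of the instructions still to be executed and the stack contents.
  The computation has halted when no instruction is left.
\<close>

type_synonym config = "prog \<times> state"

fun step :: "example_source \<Rightarrow> config \<Rightarrow> config pmf" where
  "step Q ([], s) = return_pmf ([], s)"
| "step Q (Push b v # k, s) = return_pmf (k, s(v := b # s v))"
| "step Q (Pop v # k, s) = return_pmf (k, s(v := tl (s v)))"
| "step Q (Copy v w # k, s) = return_pmf (k, s(v := s w))"
| "step Q (Flip v # k, s) = map_pmf (\<lambda>b. (k, s(v := b # s v))) (bernoulli_pmf (1 / 2))"
| "step Q (Sample v w # k, s) = map_pmf (\<lambda>(x, b). (k, s(v := x, w := [b]))) Q"
| "step Q (Branch v p q r # k, s) =
     return_pmf ((case s v of [] \<Rightarrow> p | b # _ \<Rightarrow> if b then r else q) @ k, s)"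
| "step Q (While v p # k, s) =
     return_pmf (if s v = [] then k else p @ While v p # k, s)"

primrec steps :: "example_source \<Rightarrow> nat \<Rightarrow> config \<Rightarrow> config pmf" where
  "steps Q 0 cf = return_pmf cf"
| "steps Q (Suc t) cf = bind_pmf (step Q cf) (steps Q t)"

text \<open>The inputs are placed in the first stacks; all other stacks are initially empty.\<close>

definition start :: "prog \<Rightarrow> bool list list \<Rightarrow> config" where
  "start c xs = (c, \<lambda>i. if i < length xs then xs ! i else [])"

definition halts_within :: "example_source \<Rightarrow> prog \<Rightarrow> bool list list \<Rightarrow> nat \<Rightarrow> bool" where
  "halts_within Q c xs t \<longleftrightarrow> (\<forall>cf \<in> set_pmf (steps Q t (start c xs)). fst cf = [])"

text \<open>
  The distribution of the final state, read off at the worst-case running time. It is meaningful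
  only if the running time is bounded, which is part of every notion below that refers to it.
\<close>

definition outcome :: "example_source \<Rightarrow> prog \<Rightarrow> bool list list \<Rightarrow> state pmf" where
  "outcome Q c xs = map_pmf snd (steps Q (LEAST t. halts_within Q c xs t) (start c xs))"

lemma steps_add: "steps Q (t + u) cf = bind_pmf (steps Q t cf) (steps Q u)"
  by (induction t arbitrary: cf)
    (auto simp: bind_return_pmf bind_assoc_pmf intro!: bind_pmf_cong)

lemma steps_halted: "fst cf = [] \<Longrightarrow> steps Q t cf = return_pmf cf"
  by (induction t; cases cf) (simp_all add: bind_return_pmf)

lemma outcome_eq:
  assumes "halts_within Q c xs t"
  shows "outcome Q c xs = map_pmf snd (steps Q t (start c xs))"
proof -
  define l where "l = (LEAST t. halts_within Q c xs t)"
  have l: "halts_within Q c xs l" "l \<le> t"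
    using assms unfolding l_def by (auto intro: LeastI Least_le)
  have "steps Q t (start c xs) = bind_pmf (steps Q l (start c xs)) (steps Q (t - l))"
    using l(2) by (simp flip: steps_add)
  also have "\<dots> = bind_pmf (steps Q l (start c xs)) return_pmf"
    using l(1) by (intro bind_pmf_cong refl steps_halted) (simp add: halts_within_def)
  finally show ?thesis
    by (simp add: outcome_def l_def bind_return_pmf')
qed

text \<open>An algorithm without access to examples: \<^verbatim>\<open>Sample\<close> then merely writes constants.\<close>

definition no_oracle :: example_source where
  "no_oracle = return_pmf ([], False)"

definition ppt :: "nat \<Rightarrow> prog \<Rightarrow> bool" where
  "ppt arity c \<longleftrightarrow> (\<exists>p :: nat poly. \<forall>xs. length xs = arity \<longrightarrow>
     halts_within no_oracle c xs (poly p (sum_list (map length xs))))"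

definition out_string :: "state \<Rightarrow> bool list" where
  "out_string s = s 0"

definition out_bit :: "state \<Rightarrow> bool" where
  "out_bit s \<longleftrightarrow> s 0 = [True]"

definition unary :: "nat \<Rightarrow> bool list" where
  "unary n = replicate n True"

definition cube :: "nat \<Rightarrow> bool list set" where
  "cube n = {x. length x = n}"

section \<open>Public key encryption of single bits\<close>

text \<open>
  All algorithms of a scheme, and its attackers, receive the security parameter in unary.
  Decryption is an arbitrary function; its efficiency is not needed.
\<close>

definition keypair :: "prog \<Rightarrow> nat \<Rightarrow> (bool list \<times> bool list) pmf" where
  "keypair gen n = map_pmf (\<lambda>s. (s 0, s 1)) (outcome no_oracle gen [unary n])"

definition encrypt :: "prog \<Rightarrow> nat \<Rightarrow> bool list \<Rightarrow> bool \<Rightarrow> bool list pmf" where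
  "encrypt enc n pk y = map_pmf out_string (outcome no_oracle enc [unary n, pk, [y]])"

definition pke_scheme :: "prog \<Rightarrow> prog \<Rightarrow> bool" where
  "pke_scheme gen enc \<longleftrightarrow> ppt 1 gen \<and> ppt 3 enc \<and>
     (\<forall>n>0. \<forall>(sk, pk) \<in> set_pmf (keypair gen n). \<forall>y. set_pmf (encrypt enc n pk y) \<subseteq> cube n)"

definition decryption_error ::
    "prog \<Rightarrow> prog \<Rightarrow> (bool list \<Rightarrow> bool list \<Rightarrow> bool) \<Rightarrow> nat \<Rightarrow> bool \<Rightarrow> real" where
  "decryption_error gen enc dec n y = measure_pmf.prob
     (do { (sk, pk) \<leftarrow> keypair gen n; c \<leftarrow> encrypt enc n pk y; return_pmf (dec sk c) })
     {b. b \<noteq> y}"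

definition accept_prob :: "prog \<Rightarrow> prog \<Rightarrow> prog \<Rightarrow> nat \<Rightarrow> bool \<Rightarrow> real" where
  "accept_prob gen enc D n y = measure_pmf.prob
     (do { (sk, pk) \<leftarrow> keypair gen n; c \<leftarrow> encrypt enc n pk y;
           map_pmf out_bit (outcome no_oracle D [unary n, pk, c]) })
     {b. b}"

definition secure :: "prog \<Rightarrow> prog \<Rightarrow> bool" where
  "secure gen enc \<longleftrightarrow> (\<forall>D. ppt 3 D \<longrightarrow>
     (\<forall>p :: real poly. (\<forall>\<^sub>F n in sequentially. poly p (real n) > 0) \<longrightarrow>
       (\<forall>\<^sub>F n in sequentially.
         \<bar>accept_prob gen enc D n True - accept_prob gen enc D n False\<bar> < 1 / poly p (real n))))"

definition dec_fun :: "(bool list \<Rightarrow> bool list \<Rightarrow> bool) \<Rightarrow> nat \<Rightarrow> bool list \<Rightarrow> bool list \<Rightarrow> bool" where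
  "dec_fun dec n sk = restrict (dec sk) (cube n)"

definition dec_distribution ::
    "prog \<Rightarrow> (bool list \<Rightarrow> bool list \<Rightarrow> bool) \<Rightarrow> nat \<Rightarrow> (bool list \<Rightarrow> bool) pmf" where
  "dec_distribution gen dec n = map_pmf (\<lambda>(sk, pk). dec_fun dec n sk) (keypair gen n)"

section \<open>Distributional PAC learning\<close>

definition EX_oracle :: "(bool list \<Rightarrow> bool) \<Rightarrow> bool list pmf \<Rightarrow> example_source" where
  "EX_oracle f \<rho> = map_pmf (\<lambda>x. (x, f x)) \<rho>"

text \<open>
  A learner outputs a string representing its hypothesis. \<^verbatim>\<open>H h x\<close> is the value at \<^verbatim>\<open>x\<close> of the
  hypothesis represented by \<^verbatim>\<open>h\<close>. As usual for efficient learning, hypotheses have to be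
  evaluable in polynomial time; otherwise the output of the raw sample would be a hypothesis.
\<close>

definition polytime_evaluable :: "(bool list \<Rightarrow> bool list \<Rightarrow> bool) \<Rightarrow> bool" where
  "polytime_evaluable H \<longleftrightarrow> (\<exists>c. ppt 2 c \<and>
     (\<forall>h x. map_pmf out_bit (outcome no_oracle c [h, x]) = return_pmf (H h x)))"

text \<open>The real parameters are handed to the learner as rounded-up inverses in unary.\<close>

definition learner_input :: "nat \<Rightarrow> real \<Rightarrow> real \<Rightarrow> real \<Rightarrow> bool list list" where
  "learner_input n \<epsilon> \<delta> \<eta> =
     [unary n, unary (nat \<lceil>1 / \<epsilon>\<rceil>), unary (nat \<lceil>1 / \<delta>\<rceil>), unary (nat \<lceil>1 / \<eta>\<rceil>)]"

text \<open>
  The running time must be bounded whatever examples the learner sees. A polynomial in several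
  nonnegative quantities is bounded by a polynomial in their sum, so one variable suffices.
\<close>

definition efficient_learner :: "prog \<Rightarrow> bool" where
  "efficient_learner A \<longleftrightarrow> (\<exists>p :: real poly. \<forall>n>0. \<forall>\<epsilon>>0. \<forall>\<delta>>0. \<forall>\<eta>>0.
     \<forall>Q. set_pmf Q \<subseteq> cube n \<times> UNIV \<longrightarrow>
       halts_within Q A (learner_input n \<epsilon> \<delta> \<eta>)
         (nat \<lfloor>poly p (real n + 1 / \<epsilon> + 1 / \<delta> + 1 / \<eta>)\<rfloor>))"

text \<open>
  The inner probability is over the coins of the learner and the examples it draws. These depend
  on the distribution \<open>\<rho>\<close>, so the quantification over \<open>\<rho>\<close> precedes this probability; as
  \<open>\<rho>\<close> may depend on \<open>f\<close>, it is inside the probability over \<open>f\<close>.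
\<close>

definition distributionally_PAC_learnable ::
    "(nat \<Rightarrow> (bool list \<Rightarrow> bool) set) \<Rightarrow> (nat \<Rightarrow> (bool list \<Rightarrow> bool) pmf) \<Rightarrow> bool" where
  "distributionally_PAC_learnable \<Lambda> \<mu> \<longleftrightarrow>
     (\<exists>A H. efficient_learner A \<and> polytime_evaluable H \<and>
       (\<forall>n>0. \<forall>\<epsilon>>0. \<forall>\<delta>>0. \<forall>\<eta>>0.
         measure_pmf.prob (\<mu> n) {f \<in> \<Lambda> n. \<forall>\<rho>. set_pmf \<rho> \<subseteq> cube n \<longrightarrow>
           measure_pmf.prob (map_pmf out_string (outcome (EX_oracle f \<rho>) A (learner_input n \<epsilon> \<delta> \<eta>)))
             {h. measure_pmf.prob \<rho> {x. H h x \<noteq> f x} \<le> \<epsilon>} \<ge> 1 - \<delta>} \<ge> 1 - \<eta>))"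

end

theory Submission imports Defs begin

text \<open>
  A learner yields an attacker against the scheme: given a public key and a challenge ciphertext, run
  the learner and answer each of its requests for an example with an encryption, under the public
  key, of a random bit together with this bit; then evaluate the hypothesis at the challenge.
  Had the bits been the decryptions of the ciphertexts, the examples would be honest ones for the
  distribution of encryptions of random bits, and the hypothesis would decrypt the challenge with
  probability well above one half. The bit and the decryption of a ciphertext differ only with
  negligible probability and the learner takes polynomially many steps, so replacing one kind of
  examples by the other changes its output distribution only negligibly.
\<close>

section \<open>Running programs\<close>

text \<open>The distribution of ciphertexts depends on the key pair; this is admissible for the
  learner because \<rho> is quantified after the function is fixed. Honest labels would require the
  secret key, which forces the exchange of examples. Only a \<open>Sample\<close> instruction
  consults the source, so each step of the learner costs at most the probability of a wrong label.
  This loss is linear in the decryption error of the individual key pair and can therefore be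
  averaged over keys directly, without singling out bad keys by a Markov argument.

  Accuracy, confidence and fraction of functions are all one constant \<open>a\<close>. A random bit
  is then mispredicted with probability at most \<open>3 * a\<close> plus the exchange loss: one
  \<open>a\<close> for keys on which learning fails, one for failing runs, one for the error of the
  hypothesis. Guessing error r corresponds to advantage 1 - 2 r, whence \<open>6 * a\<close>; the
  choice 1/12 leaves 1/2.

  The attacker is a concrete program that must be polynomial on all strings, even on public keys
  that are never generated. Hence distributions and explicit time bounds are carried together
  through all program constructions.\<close>

definition runs :: "example_source \<Rightarrow> prog \<Rightarrow> state \<Rightarrow> nat \<Rightarrow> state pmf \<Rightarrow> bool" where
  "runs Q p s t M \<longleftrightarrow> steps Q t (p, s) = map_pmf (Pair []) M"

lemma map_Pair_Nil_eqD: "map_pmf (Pair c) M = map_pmf (Pair c) N \<Longrightarrow> M = N"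
  by (rule pmf.inj_map_strong[of _ _ "Pair c" "Pair c"]) auto

lemma runs_Nil [simp]: "runs Q [] s t M \<longleftrightarrow> M = return_pmf s"
proof
  assume "runs Q [] s t M"
  then have "map_pmf (Pair ([] :: prog)) M = map_pmf (Pair []) (return_pmf s)"
    by (simp add: runs_def steps_halted)
  then show "M = return_pmf s"
    by (rule map_Pair_Nil_eqD)
qed (simp add: runs_def steps_halted)

lemma runs_0_iff: "runs Q p s 0 M \<longleftrightarrow> p = [] \<and> M = return_pmf s"
proof
  assume *: "runs Q p s 0 M"
  then have "(p, s) \<in> set_pmf (map_pmf (Pair []) M)"
    by (simp add: runs_def flip: * [unfolded runs_def])
  with * show "p = [] \<and> M = return_pmf s"
    using runs_Nil by auto
qed auto

lemma runs_iff_halting: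
  "runs Q p s t M \<longleftrightarrow>
     (\<forall>cf \<in> set_pmf (steps Q t (p, s)). fst cf = []) \<and> M = map_pmf snd (steps Q t (p, s))"
proof
  assume "(\<forall>cf \<in> set_pmf (steps Q t (p, s)). fst cf = []) \<and> M = map_pmf snd (steps Q t (p, s))"
  moreover from this have "map_pmf (\<lambda>cf. ([], snd cf)) (steps Q t (p, s)) = map_pmf id (steps Q t (p, s))"
    by (intro map_pmf_cong) (auto simp: prod_eq_iff)
  ultimately show "runs Q p s t M"
    by (simp add: runs_def pmf.map_comp o_def)
qed (auto simp: runs_def pmf.map_comp o_def)

lemma halts_within_iff_runs:
  "halts_within Q c xs t \<longleftrightarrow> runs Q c (snd (start c xs)) t (outcome Q c xs)"
  using outcome_eq[of Q c xs t] by (auto simp: runs_iff_halting halts_within_def start_def)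

lemma runs_halts_within:
  "runs Q c (snd (start c xs)) t M \<Longrightarrow> halts_within Q c xs t"
  by (simp add: runs_iff_halting halts_within_def start_def)

lemma runs_outcome:
  "runs Q c (snd (start c xs)) t M \<Longrightarrow> outcome Q c xs = M"
  using outcome_eq[of Q c xs t] by (simp add: runs_iff_halting halts_within_def start_def)

text \<open>Halted configurations are absorbing, so the time in \<open>runs\<close> acts as an upper
  bound while the final distribution stays exact.\<close>

lemma runs_mono:
  assumes "runs Q p s t M" "t \<le> u"
  shows "runs Q p s u M"
proof -
  have "steps Q u (p, s) = bind_pmf (steps Q t (p, s)) (steps Q (u - t))"
    using assms(2) by (simp flip: steps_add)
  also have "\<dots> = map_pmf (Pair []) M"
    using assms(1) by (simp add: runs_def bind_map_pmf steps_halted flip: map_pmf_def)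
  finally show ?thesis
    by (simp add: runs_def)
qed

lemma step_append:
  "p \<noteq> [] \<Longrightarrow> step Q (p @ k, s) = map_pmf (\<lambda>(q, s'). (q @ k, s')) (step Q (p, s))"
  by (cases "(Q, (p, s))" rule: step.cases)
    (auto simp: pmf.map_comp o_def case_prod_unfold split: list.splits)

text \<open>Until \<open>p\<close> is exhausted no step looks at the continuation \<open>k\<close>,
  so the runs concatenate. The bound \<open>u\<close> is uniform over the final states of
  \<open>p\<close> because running times are worst-case.\<close>

lemma runs_append:
  assumes "runs Q p s t M" "\<And>s'. s' \<in> set_pmf M \<Longrightarrow> runs Q k s' u (N s')"
  shows "runs Q (p @ k) s (t + u) (bind_pmf M N)"
  using assms
proof (induction t arbitrary: p s M)
  case 0
  then show ?case by (auto simp: runs_0_iff bind_return_pmf)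
next
  case (Suc t)
  show ?case
  proof (cases "p = []")
    case True
    with Suc.prems show ?thesis
      by (auto simp: bind_return_pmf intro: runs_mono)
  next
    case False
    define X where "X = step Q (p, s)"
    have M: "bind_pmf X (steps Q t) = map_pmf (Pair []) M"
      using Suc.prems(1) by (simp add: runs_def X_def)
    have snd_M: "M = bind_pmf X (\<lambda>cf. map_pmf snd (steps Q t cf))"
    proof -
      have "M = map_pmf snd (bind_pmf X (steps Q t))"
        by (simp add: M pmf.map_comp o_def)
      then show ?thesis by (simp only: map_bind_pmf)
    qed
    \<comment> \<open>The successors of the first step inherit halting and the assumption on
      \<open>k\<close> from the mixture \<open>M\<close>, since their final states lie in its
      support.\<close>
    have eq: "steps Q (t + u) (q @ k, s') =
        map_pmf (Pair []) (bind_pmf (map_pmf snd (steps Q t (q, s'))) N)" if X: "(q, s') \<in> set_pmf X" for q s'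
    proof -
      have "fst cf = []" if "cf \<in> set_pmf (steps Q t (q, s'))" for cf
      proof -
        have "cf \<in> set_pmf (bind_pmf X (steps Q t))" using X that by auto
        then show ?thesis unfolding M by auto
      qed
      then have "runs Q q s' t (map_pmf snd (steps Q t (q, s')))"
        by (simp add: runs_iff_halting)
      moreover have "set_pmf (map_pmf snd (steps Q t (q, s'))) \<subseteq> set_pmf M"
        using X by (force simp: snd_M)
      ultimately show ?thesis
        using Suc.IH[of q s' "map_pmf snd (steps Q t (q, s'))"] Suc.prems(2)
        unfolding runs_def[of _ "q @ k"] by blast
    qed
    have "steps Q (Suc t + u) (p @ k, s) = bind_pmf X (\<lambda>(q, s'). steps Q (t + u) (q @ k, s'))"
      using False by (simp add: step_append X_def bind_map_pmf case_prod_unfold)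
    also have "\<dots> = bind_pmf X (\<lambda>cf. map_pmf (Pair []) (bind_pmf (map_pmf snd (steps Q t cf)) N))"
      using eq by (intro bind_pmf_cong) auto
    also have "\<dots> = map_pmf (Pair []) (bind_pmf M N)"
      by (simp add: snd_M map_bind_pmf bind_assoc_pmf)
    finally show ?thesis by (simp add: runs_def)
  qed
qed

lemma runs_append_return:
  assumes "runs Q p s t (return_pmf s')" "runs Q k s' u N"
  shows "runs Q (p @ k) s (t + u) N"
  using runs_append[OF assms(1), of k u "\<lambda>_. N"] assms(2) by (simp add: bind_return_pmf)

lemma runs_Push [simp]: "runs Q (Push b v # k) s (Suc t) M \<longleftrightarrow> runs Q k (s(v := b # s v)) t M"
  and runs_Pop [simp]: "runs Q (Pop v # k) s (Suc t) M \<longleftrightarrow> runs Q k (s(v := tl (s v))) t M"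
  and runs_Copy [simp]: "runs Q (Copy v w # k) s (Suc t) M \<longleftrightarrow> runs Q k (s(v := s w)) t M"
  and runs_Branch [simp]: "runs Q (Branch v p q r # k) s (Suc t) M \<longleftrightarrow>
    runs Q ((case s v of [] \<Rightarrow> p | b # _ \<Rightarrow> if b then r else q) @ k) s t M"
  and runs_While [simp]: "runs Q (While v p # k) s (Suc t) M \<longleftrightarrow>
    runs Q (if s v = [] then k else p @ While v p # k) s t M"
  by (simp_all add: runs_def bind_return_pmf)

lemma runs_Flip:
  assumes "\<And>b. runs Q k (s(v := b # s v)) t (N b)"
  shows "runs Q (Flip v # k) s (Suc t) (bind_pmf (bernoulli_pmf (1 / 2)) N)"
  using assms by (simp add: runs_def bind_map_pmf map_bind_pmf)

section \<open>Simulating a program with a source of examples\<close>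

fun width :: "prog \<Rightarrow> nat" where
  "width [] = 0"
| "width (Push b v # k) = max (Suc v) (width k)"
| "width (Pop v # k) = max (Suc v) (width k)"
| "width (Copy v w # k) = max (max (Suc v) (Suc w)) (width k)"
| "width (Flip v # k) = max (Suc v) (width k)"
| "width (Sample v w # k) = max (max (Suc v) (Suc w)) (width k)"
| "width (Branch v p q r # k) =
     max (Suc v) (max (max (width p) (width q)) (max (width r) (width k)))"
| "width (While v p # k) = max (Suc v) (max (width p) (width k))"

lemma width_append [simp]: "width (p @ k) = max (width p) (width k)"
  by (induction p rule: width.induct) (auto simp: ac_simps)

fun translate :: "(nat \<Rightarrow> nat) \<Rightarrow> (nat \<Rightarrow> nat \<Rightarrow> prog) \<Rightarrow> prog \<Rightarrow> prog" where
  "translate f blk [] = []"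
| "translate f blk (Push b v # k) = Push b (f v) # translate f blk k"
| "translate f blk (Pop v # k) = Pop (f v) # translate f blk k"
| "translate f blk (Copy v w # k) = Copy (f v) (f w) # translate f blk k"
| "translate f blk (Flip v # k) = Flip (f v) # translate f blk k"
| "translate f blk (Sample v w # k) = blk v w @ translate f blk k"
| "translate f blk (Branch v p q r # k) =
     Branch (f v) (translate f blk p) (translate f blk q) (translate f blk r) # translate f blk k"
| "translate f blk (While v p # k) = While (f v) (translate f blk p) # translate f blk k"

lemma translate_append [simp]:
  "translate f blk (p @ k) = translate f blk p @ translate f blk k"
  by (induction p rule: width.induct) auto

text \<open>Stacks from \<open>B\<close> on read as empty, as they are in a start state with at most
  \<open>B\<close> inputs; a program of width at most \<open>B\<close> never touches them.\<close>

definition view :: "(nat \<Rightarrow> nat) \<Rightarrow> nat \<Rightarrow> state \<Rightarrow> state" where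
  "view f B s = (\<lambda>v. if v < B then s (f v) else [])"

text \<open>
  A program with source \<open>Q\<close> is simulated on the stacks \<open>f ` {..<B}\<close> of a program with source \<open>Q'\<close>,
  in which \<open>blk v w\<close> takes over the role of \<^verbatim>\<open>Sample v w\<close>.
\<close>

locale simulation =
  fixes f :: "nat \<Rightarrow> nat" and blk :: "nat \<Rightarrow> nat \<Rightarrow> prog" and B T :: nat
    and Q Q' :: example_source and Inv :: "state \<Rightarrow> bool"
  assumes inj: "inj_on f {..<B}"
    and Inv_upd: "Inv s \<Longrightarrow> v < B \<Longrightarrow> Inv (s(f v := x))"
    and blk: "v < B \<Longrightarrow> w < B \<Longrightarrow> Inv s \<Longrightarrow>
      \<exists>M. runs Q' (blk v w) s T M \<and> (\<forall>s' \<in> set_pmf M. Inv s') \<and>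
        map_pmf (view f B) M = map_pmf (\<lambda>(x, b). (view f B s)(v := x, w := [b])) Q"
    and T: "0 < T"
begin

lemma view_upd: "v < B \<Longrightarrow> view f B (s(f v := x)) = (view f B s)(v := x)"
  using inj by (auto simp: view_def fun_eq_iff inj_on_def)

text \<open>\<open>N\<close> pairs the remaining simulated program with a state of the simulating
  one, so that both sides of the simulation can be read off it. The last clause is in continuation
  style: runs for all successors yield a run of the whole. Every simulated step is charged
  \<open>T\<close>, which covers the single step taken here because \<open>T\<close> is
  positive.\<close>

lemma simulate_det:
  assumes "step Q (p, view f B s) = return_pmf (p', view f B s1)" "Inv s1" "width p' \<le> B"
    and "step Q' (translate f blk p, s) = return_pmf (translate f blk p', s1)"
  shows "\<exists>N. step Q (p, view f B s) = map_pmf (\<lambda>(k, s'). (k, view f B s')) N \<and>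
    (\<forall>(k, s') \<in> set_pmf N. Inv s' \<and> width k \<le> B) \<and>
    (\<forall>u F. (\<forall>(k, s') \<in> set_pmf N. runs Q' (translate f blk k) s' u (F (k, s'))) \<longrightarrow>
      runs Q' (translate f blk p) s (T + u) (bind_pmf N F))"
proof (intro exI[of _ "return_pmf (p', s1)"] conjI allI impI)
  fix u F
  assume "\<forall>(k, s') \<in> set_pmf (return_pmf (p', s1)). runs Q' (translate f blk k) s' u (F (k, s'))"
  then have "runs Q' (translate f blk p) s (Suc u) (bind_pmf (return_pmf (p', s1)) F)"
    using assms(4) by (simp add: runs_def bind_return_pmf)
  then show "runs Q' (translate f blk p) s (T + u) (bind_pmf (return_pmf (p', s1)) F)"
    by (rule runs_mono) (use T in auto)
qed (use assms in auto)

lemma simulate_step: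
  assumes "Inv s" "width p \<le> B" "p \<noteq> []"
  shows "\<exists>N. step Q (p, view f B s) = map_pmf (\<lambda>(k, s'). (k, view f B s')) N \<and>
    (\<forall>(k, s') \<in> set_pmf N. Inv s' \<and> width k \<le> B) \<and>
    (\<forall>u F. (\<forall>(k, s') \<in> set_pmf N. runs Q' (translate f blk k) s' u (F (k, s'))) \<longrightarrow>
      runs Q' (translate f blk p) s (T + u) (bind_pmf N F))"
proof -
  obtain i k where p: "p = i # k" using \<open>p \<noteq> []\<close> by (cases p) auto
  show ?thesis
  proof (cases i)
    case (Push b v)
    with assms p show ?thesis
      by (intro simulate_det[of _ _ k "s(f v := b # s (f v))"]) (auto simp: view_upd Inv_upd, auto simp: view_def)
  next
    case (Pop v)
    with assms p show ?thesis
      by (intro simulate_det[of _ _ k "s(f v := tl (s (f v)))"]) (auto simp: view_upd Inv_upd, auto simp: view_def)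
  next
    case (Copy v w)
    with assms p show ?thesis
      by (intro simulate_det[of _ _ k "s(f v := s (f w))"]) (auto simp: view_upd Inv_upd, auto simp: view_def)
  next
    case (Branch v q0 q1 q2)
    with assms p show ?thesis
      by (intro simulate_det[of _ _ "(case s (f v) of [] \<Rightarrow> q0 | b # _ \<Rightarrow> if b then q2 else q1) @ k" s])
        (auto simp: view_def split: list.splits)
  next
    case (While v q)
    with assms p show ?thesis
      by (intro simulate_det[of _ _ "if s (f v) = [] then k else q @ While v q # k" s])
        (auto simp: view_def)
  next
    case (Flip v)
    define N where "N = map_pmf (\<lambda>b. (k, s(f v := b # s (f v)))) (bernoulli_pmf (1 / 2))"
    have v: "v < B" using assms p Flip by auto
    show ?thesis
    proof (intro exI[of _ N] conjI allI impI)
      show "step Q (p, view f B s) = map_pmf (\<lambda>(k, s'). (k, view f B s')) N"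
        using v by (simp add: p Flip N_def pmf.map_comp o_def view_upd) (simp add: view_def)
      show "\<forall>(k, s') \<in> set_pmf N. Inv s' \<and> width k \<le> B"
        using assms p Flip v by (auto simp: N_def Inv_upd)
      fix u F
      assume "\<forall>(k, s') \<in> set_pmf N. runs Q' (translate f blk k) s' u (F (k, s'))"
      then have "runs Q' (translate f blk p) s (Suc u)
          (bind_pmf (bernoulli_pmf (1 / 2)) (\<lambda>b. F (k, s(f v := b # s (f v)))))"
        using runs_Flip[of Q' "translate f blk k" s "f v" u "\<lambda>b. F (k, s(f v := b # s (f v)))"]
        by (simp add: N_def p Flip)
      then have "runs Q' (translate f blk p) s (Suc u) (bind_pmf N F)"
        by (simp add: N_def bind_map_pmf)
      then show "runs Q' (translate f blk p) s (T + u) (bind_pmf N F)"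
        by (rule runs_mono) (use T in auto)
    qed
  next
    case (Sample v w)
    have vw: "v < B" "w < B" using assms p Sample by auto
    from blk[OF vw assms(1)] obtain M where M: "runs Q' (blk v w) s T M" "\<forall>s' \<in> set_pmf M. Inv s'"
      "map_pmf (view f B) M = map_pmf (\<lambda>(x, b). (view f B s)(v := x, w := [b])) Q" by blast
    show ?thesis
    proof (intro exI[of _ "map_pmf (Pair k) M"] conjI allI impI)
      have "step Q (p, view f B s) =
          map_pmf (Pair k) (map_pmf (\<lambda>(x, b). (view f B s)(v := x, w := [b])) Q)"
        by (simp add: p Sample pmf.map_comp o_def case_prod_unfold)
      also have "\<dots> = map_pmf (\<lambda>(k, s'). (k, view f B s')) (map_pmf (Pair k) M)"
        by (simp add: pmf.map_comp o_def flip: M(3))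
      finally show "step Q (p, view f B s) = map_pmf (\<lambda>(k, s'). (k, view f B s')) (map_pmf (Pair k) M)" .
      show "\<forall>(k, s') \<in> set_pmf (map_pmf (Pair k) M). Inv s' \<and> width k \<le> B"
        using assms p Sample M by auto
      fix u F
      assume "\<forall>(k, s') \<in> set_pmf (map_pmf (Pair k) M). runs Q' (translate f blk k) s' u (F (k, s'))"
      then show "runs Q' (translate f blk p) s (T + u) (bind_pmf (map_pmf (Pair k) M) F)"
        by (auto simp: p Sample bind_map_pmf intro!: runs_append M(1))
    qed
  qed
qed

theorem simulate:
  assumes "runs Q p (view f B s) t R" "Inv s" "width p \<le> B"
  shows "\<exists>M. runs Q' (translate f blk p) s (T * t) M \<and> (\<forall>s' \<in> set_pmf M. Inv s') \<and>
    map_pmf (view f B) M = R"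
  using assms
proof (induction t arbitrary: p s R)
  case 0
  then show ?case by (auto simp: runs_0_iff)
next
  case (Suc t)
  show ?case
  proof (cases "p = []")
    case True
    with Suc.prems show ?thesis by auto
  next
    case False
    obtain N where N: "step Q (p, view f B s) = map_pmf (\<lambda>(k, s'). (k, view f B s')) N"
      "\<And>k s'. (k, s') \<in> set_pmf N \<Longrightarrow> Inv s' \<and> width k \<le> B"
      "\<And>u F. (\<And>k s'. (k, s') \<in> set_pmf N \<Longrightarrow> runs Q' (translate f blk k) s' u (F (k, s'))) \<Longrightarrow>
        runs Q' (translate f blk p) s (T + u) (bind_pmf N F)"
      using simulate_step[OF Suc.prems(2,3) False] by fast
    define R' where "R' k s' = map_pmf snd (steps Q t (k, view f B s'))" for k s'
    have steps: "steps Q (Suc t) (p, view f B s) =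
        bind_pmf N (\<lambda>(k, s'). steps Q t (k, view f B s'))"
      by (simp add: N(1) bind_map_pmf case_prod_unfold)
    have "\<exists>M. runs Q' (translate f blk k) s' (T * t) M \<and> (\<forall>s' \<in> set_pmf M. Inv s') \<and>
        map_pmf (view f B) M = R' k s'" if N': "(k, s') \<in> set_pmf N" for k s'
    proof (rule Suc.IH)
      have "fst cf = []" if "cf \<in> set_pmf (steps Q t (k, view f B s'))" for cf
      proof -
        have "cf \<in> set_pmf (steps Q (Suc t) (p, view f B s))"
          using N' that unfolding steps by force
        then show ?thesis using Suc.prems(1) by (auto simp: runs_iff_halting)
      qed
      then show "runs Q k (view f B s') t (R' k s')"
        by (simp add: runs_iff_halting R'_def)
    qed (use N(2)[OF N'] in auto)
    \<comment> \<open>The runs after the first step are only known to exist; a choice of one per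
      successor supplies the \<open>F\<close> demanded by \<open>simulate_step\<close>.\<close>
    then obtain F where F: "\<And>k s'. (k, s') \<in> set_pmf N \<Longrightarrow>
        runs Q' (translate f blk k) s' (T * t) (F (k, s')) \<and>
        (\<forall>s' \<in> set_pmf (F (k, s')). Inv s') \<and> map_pmf (view f B) (F (k, s')) = R' k s'"
      using bchoice[of "set_pmf N" "\<lambda>(k, s') M. runs Q' (translate f blk k) s' (T * t) M \<and>
        (\<forall>s' \<in> set_pmf M. Inv s') \<and> map_pmf (view f B) M = R' k s'"] by fast
    show ?thesis
    proof (intro exI[of _ "bind_pmf N F"] conjI)
      show "runs Q' (translate f blk p) s (T * Suc t) (bind_pmf N F)"
        using N(3)[of "T * t" F] F by simp
      show "\<forall>s' \<in> set_pmf (bind_pmf N F). Inv s'"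
        using F by auto
      have "R = map_pmf snd (bind_pmf N (\<lambda>(k, s'). steps Q t (k, view f B s')))"
        using Suc.prems(1) steps by (simp add: runs_iff_halting)
      also have "\<dots> = bind_pmf N (\<lambda>(k, s'). R' k s')"
        by (simp add: map_bind_pmf R'_def case_prod_unfold)
      also have "\<dots> = bind_pmf N (\<lambda>ks. map_pmf (view f B) (F ks))"
        using F by (intro bind_pmf_cong) auto
      finally show "map_pmf (view f B) (bind_pmf N F) = R"
        by (simp add: map_bind_pmf)
    qed
  qed
qed

end

section \<open>Renaming stacks and calling subroutines\<close>

definition rename :: "(nat \<Rightarrow> nat) \<Rightarrow> prog \<Rightarrow> prog" where
  "rename f = translate f (\<lambda>v w. [Sample (f v) (f w)])"

text \<open>The case of the simulation in which an example is still requested by one instruction, so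
  that \<open>T\<close> is 1 and the time is unchanged. The frame condition on stacks outside the
  block serves as the invariant.\<close>

lemma runs_rename:
  assumes "runs Q p (view f B s) t R" "inj_on f {..<B}" "width p \<le> B"
  obtains M where "runs Q (rename f p) s t M" "map_pmf (view f B) M = R"
    "\<And>s' i. s' \<in> set_pmf M \<Longrightarrow> i \<notin> f ` {..<B} \<Longrightarrow> s' i = s i"
proof -
  interpret simulation f "\<lambda>v w. [Sample (f v) (f w)]" B 1 Q Q "\<lambda>s'. \<forall>i. i \<notin> f ` {..<B} \<longrightarrow> s' i = s i"
  proof (standard, goal_cases)
    case (3 v w s1)
    have upd: "view f B (s1(f v := x, f w := [b])) = (view f B s1)(v := x, w := [b])" for x b
      using 3 assms(2) by (auto simp: view_def fun_eq_iff inj_on_def)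
    show ?case
      using 3 by (intro exI[of _ "map_pmf (\<lambda>(x, b). s1(f v := x, f w := [b])) Q"])
        (auto simp: runs_def pmf.map_comp o_def case_prod_unfold upd bind_map_pmf map_pmf_def[symmetric]
          simp flip: map_pmf_def)
  qed (use assms in auto)
  show ?thesis
    using simulate[OF assms(1) _ assms(3)] that by (auto simp: rename_def)
qed

text \<open>The block of the subroutine must look like a start state, and the result appears in
  \<open>f 0\<close>. The rest of the block may be left dirty, so a repeated call has to clear it
  first.\<close>

lemma runs_call:
  assumes "halts_within Q c xs t" "width c \<le> B" "length xs \<le> B" "0 < B" "inj_on f {..<B}"
    and s: "\<And>i. i < B \<Longrightarrow> s (f i) = (if i < length xs then xs ! i else [])"
  obtains M where "runs Q (rename f c) s t M"
    "map_pmf (\<lambda>s'. s' (f 0)) M = map_pmf out_string (outcome Q c xs)"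
    "\<And>s' i. s' \<in> set_pmf M \<Longrightarrow> i \<notin> f ` {..<B} \<Longrightarrow> s' i = s i"
proof -
  have "view f B s = snd (start c xs)"
    using assms(3) by (auto simp: view_def start_def s fun_eq_iff)
  with assms(1) have "runs Q c (view f B s) t (outcome Q c xs)"
    by (simp add: halts_within_iff_runs)
  from runs_rename[OF this assms(5,2)] obtain M where
    M: "runs Q (rename f c) s t M" "map_pmf (view f B) M = outcome Q c xs"
      "\<And>s' i. s' \<in> set_pmf M \<Longrightarrow> i \<notin> f ` {..<B} \<Longrightarrow> s' i = s i" by blast
  have "map_pmf (\<lambda>s'. s' (f 0)) M = map_pmf out_string (map_pmf (view f B) M)"
    using assms(4) by (simp add: pmf.map_comp o_def out_string_def view_def)
  with M show ?thesis
    by (intro that) auto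
qed

text \<open>Bounds the length of the learner's hypothesis, on which the time for evaluating it
  depends. A step pushes one bit, pops, copies an existing stack, or writes an instance of length
  \<open>n\<close> and a one-bit label.\<close>

lemma steps_stack_length:
  assumes "set_pmf Q \<subseteq> cube n \<times> UNIV" "\<And>v. length (s v) \<le> m" "n \<le> m" "0 < m"
    and "(q, s') \<in> set_pmf (steps Q t (p, s))"
  shows "length (s' v) \<le> m + t"
  using assms(2-)
proof (induction t arbitrary: p s m)
  case 0
  then show ?case by simp
next
  case (Suc t)
  then obtain p1 s1 where 1: "(p1, s1) \<in> set_pmf (step Q (p, s))"
    "(q, s') \<in> set_pmf (steps Q t (p1, s1))" by auto
  have m: "length (s v) \<le> Suc m" "length (s v) - Suc 0 \<le> Suc m" "length (s v) \<le> m" for v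
    using Suc.prems(1)[of v] by auto
  have "length (s1 v) \<le> Suc m" for v
    using 1(1) m Suc.prems(2,3) assms(1)
    by (cases "(Q, (p, s))" rule: step.cases) (auto simp: cube_def split: if_splits)
  from Suc.IH[OF this _ _ 1(2)] Suc.prems show ?case by auto
qed

section \<open>Loops over stacks\<close>

lemma runs_unary_loop:
  assumes "v \<noteq> w"
  shows "runs Q [While v [Pop v, Push True w]] s (3 * length (s v) + 1)
    (return_pmf (s(v := [], w := unary (length (s v)) @ s w)))"
proof (induction "s v" arbitrary: s)
  case Nil
  then show ?case by (auto simp: fun_eq_iff unary_def)
next
  case (Cons b bs)
  define u where "u = 3 * length bs + 1"
  let ?s = "s(v := bs, w := True # s w)"
  have "runs Q [While v [Pop v, Push True w]] ?s u
      (return_pmf (?s(v := [], w := unary (length bs) @ True # s w)))"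
    using Cons(1)[of ?s] assms by (simp add: fun_upd_twist u_def)
  moreover have "?s(v := [], w := unary (length bs) @ True # s w) =
      s(v := [], w := unary (length (s v)) @ s w)"
    using assms by (auto simp: fun_eq_iff unary_def replicate_app_Cons_same simp flip: Cons(2))
  moreover have time: "3 * length (s v) + 1 = Suc (Suc (Suc u))"
    by (simp flip: Cons(2) add: u_def)
  ultimately show ?case
    unfolding time using assms by (simp flip: Cons(2) add: fun_upd_twist)
qed

text \<open>
  On a malformed public key the ciphertexts may have any length, and then nothing is known about the
  running time of the learner. Padding them keeps the attacker polynomial on all inputs, and
  does nothing to honest ciphertexts.
\<close>

fun pad :: "nat \<Rightarrow> bool list \<Rightarrow> bool list" where
  "pad 0 y = []"
| "pad (Suc n) y = (y \<noteq> [] \<and> hd y) # pad n (tl y)"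

lemma length_pad [simp]: "length (pad n y) = n"
  by (induction n y rule: pad.induct) auto

lemma pad_eq_self: "length y = n \<Longrightarrow> pad n y = y"
  by (induction n y rule: pad.induct) (auto simp: length_Suc_conv)

text \<open>Each round takes five steps (loop test, pop, branch, push, pop), and the final test
  takes one more. An exhausted stack \<open>e\<close> contributes a 0 and stays empty when popped,
  which realises \<open>pad\<close>. Pushing the bits one by one leaves them reversed.\<close>

lemma runs_pad_loop:
  assumes "distinct [c, e, r]"
  shows "runs Q [While c [Pop c, Branch e [Push False r] [Push False r] [Push True r], Pop e]] s
      (5 * length (s c) + 1)
    (return_pmf (s(c := [], e := drop (length (s c)) (s e), r := rev (pad (length (s c)) (s e)) @ s r)))"
proof (induction "s c" arbitrary: s)
  case Nil
  then show ?case by (auto simp: fun_eq_iff)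
next
  case (Cons b bs)
  define u where "u = 5 * length bs + 1"
  let ?s = "s(c := bs, r := (s e \<noteq> [] \<and> hd (s e)) # s r, e := tl (s e))"
  have len: "length (s c) = Suc (length bs)" by (simp flip: Cons(2))
  have "runs Q [While c [Pop c, Branch e [Push False r] [Push False r] [Push True r], Pop e]] ?s u
      (return_pmf (?s(c := [], e := drop (length bs) (tl (s e)),
        r := rev (pad (length bs) (tl (s e))) @ (s e \<noteq> [] \<and> hd (s e)) # s r)))"
    using Cons(1)[of ?s] assms by (simp add: fun_upd_twist u_def)
  moreover have time: "5 * length (s c) + 1 = Suc (Suc (Suc (Suc (Suc u))))"
    by (simp add: len u_def)
  ultimately show ?case
    unfolding time using assms by (cases "s e") (auto simp flip: Cons(2) simp add: fun_upd_twist)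
qed

text \<open>Restores the order of the bits after the padding loop, at four steps per bit. The loop
  test guarantees that the empty case of the branch is never reached.\<close>

lemma runs_rev_loop:
  assumes "v \<noteq> w"
  shows "runs Q [While v [Branch v [] [Push False w] [Push True w], Pop v]] s (4 * length (s v) + 1)
    (return_pmf (s(v := [], w := rev (s v) @ s w)))"
proof (induction "s v" arbitrary: s)
  case Nil
  then show ?case by (auto simp: fun_eq_iff)
next
  case (Cons b bs)
  define u where "u = 4 * length bs + 1"
  let ?s = "s(w := b # s w, v := bs)"
  have "runs Q [While v [Branch v [] [Push False w] [Push True w], Pop v]] ?s u
      (return_pmf (?s(v := [], w := rev bs @ b # s w)))"
    using Cons(1)[of ?s] assms by (simp add: fun_upd_twist u_def)
  moreover have time: "4 * length (s v) + 1 = Suc (Suc (Suc (Suc u)))"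
    by (simp flip: Cons(2) add: u_def)
  ultimately show ?case
    unfolding time using assms by (cases b) (simp_all flip: Cons(2) add: fun_upd_twist)
qed

lemma runs_clear:
  assumes "s z = []" "z \<notin> f ` set vs"
  shows "runs Q (map (\<lambda>i. Copy (f i) z) vs) s (length vs)
    (return_pmf (\<lambda>j. if j \<in> f ` set vs then [] else s j))"
  using assms
proof (induction vs arbitrary: s)
  case Nil
  then show ?case by simp
next
  case (Cons i vs)
  have "(\<lambda>j. if j \<in> f ` set vs then [] else (s(f i := [])) j) =
      (\<lambda>j. if j \<in> f ` set (i # vs) then [] else s j)"
    by (auto simp: fun_eq_iff)
  moreover have "runs Q (map (\<lambda>i. Copy (f i) z) vs) (s(f i := [])) (length vs)
      (return_pmf (\<lambda>j. if j \<in> f ` set vs then [] else (s(f i := [])) j))"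
    using Cons.prems by (intro Cons.IH) auto
  ultimately show ?case
    by (simp only: list.map length_Cons runs_Copy Cons.prems(1))
qed

section \<open>Polynomial time bounds\<close>

lemma poly_mono_nat: "x \<le> y \<Longrightarrow> poly (p :: nat poly) x \<le> poly p y"
  by (induction p) (auto intro!: add_mono mult_mono)

text \<open>Turns the real time bound of the learner into one with natural coefficients, as
  \<open>ppt\<close> demands: \<open>c\<close> stands for the sum of the fixed inverse parameters,
  and all coefficients are replaced by natural upper bounds of their absolute values.\<close>

lemma abs_real_poly_le_nat_poly:
  "\<exists>q :: nat poly. \<forall>n. \<bar>poly p (real n + c)\<bar> \<le> real (poly q n)"
proof (induction p)
  case 0
  show ?case by (intro exI[of _ 0]) simp
next
  case (pCons a p)
  then obtain q where q: "\<And>n. \<bar>poly p (real n + c)\<bar> \<le> real (poly q n)" by blast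
  obtain A C :: nat where A: "\<bar>a\<bar> \<le> real A" and C: "\<bar>c\<bar> \<le> real C"
    by (meson real_arch_simple)
  have "\<bar>poly (pCons a p) (real n + c)\<bar> \<le> real (poly ([:A:] + [:C, 1:] * q) n)" for n
  proof -
    have "\<bar>poly (pCons a p) (real n + c)\<bar> \<le> \<bar>a\<bar> + \<bar>real n + c\<bar> * \<bar>poly p (real n + c)\<bar>"
      by (simp add: abs_triangle_ineq flip: abs_mult)
    also have "\<dots> \<le> real A + (real C + real n) * real (poly q n)"
      using A C q[of n] by (intro add_mono mult_mono) auto
    finally show ?thesis by (simp add: algebra_simps)
  qed
  then show ?case by blast
qed

section \<open>The attacker\<close>

text \<open>
  The stacks of the learner, of the encryption algorithm and of the hypothesis evaluator are placed
  in the residue classes 3, 0 and 1 modulo 4, away from the inputs 0, 1, 2 and the working stacks of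
  the attacker: 6 is always empty (copying it clears a stack), 10 holds the security parameter,
  18 the label and 26 the instance of a simulated example.
\<close>

definition emb :: "nat \<Rightarrow> nat \<Rightarrow> nat" where
  "emb r v = 4 * v + r"

text \<open>Apart from the inputs these are all 2 modulo 4. Stack 14 is the loop counter of
  \<open>deliver\<close> and 22 its reversal buffer. The offsets 4 and 5, in place of 0 and 1, keep
  the other blocks off the input stacks 0 and 1.\<close>

definition reserved :: "nat set" where
  "reserved = {0, 1, 2, 6, 10, 14, 18, 22, 26}"

lemma emb_eq_emb_iff [simp]:
  assumes "r \<in> {3, 4, 5}" "r' \<in> {3, 4, 5}"
  shows "emb r v = emb r' w \<longleftrightarrow> r = r' \<and> v = w"
  using assms unfolding emb_def by (elim insertE emptyE) (hypsubst, presburger)+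

lemma emb_neq_reserved [simp]:
  assumes "r \<in> {3, 4, 5}" "i \<in> reserved"
  shows "emb r v \<noteq> i" "i \<noteq> emb r v"
  using assms unfolding emb_def reserved_def by (elim insertE emptyE; hypsubst; presburger)+

lemma reserved_simps [simp]:
  "0 \<in> reserved" "Suc 0 \<in> reserved" "1 \<in> reserved" "2 \<in> reserved" "6 \<in> reserved" "10 \<in> reserved"
  "14 \<in> reserved" "18 \<in> reserved" "22 \<in> reserved" "26 \<in> reserved"
  by (auto simp: reserved_def)

lemma inj_on_emb [simp]: "inj_on (emb r) X"
  by (auto simp: inj_on_def emb_def)

text \<open>The invariant while the learner is simulated. The evaluator's block must stay empty,
  since it is used once and never cleared; the encryption block is left unconstrained because every
  call clears it.\<close>

definition env :: "nat \<Rightarrow> bool list \<Rightarrow> bool list \<Rightarrow> state \<Rightarrow> bool" where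
  "env n pk ct s \<longleftrightarrow> s 1 = pk \<and> s 2 = ct \<and> s 6 = [] \<and> s 10 = unary n \<and> (\<forall>i. s (emb 5 i) = [])"

section \<open>Simulated examples\<close>

definition sim_source :: "prog \<Rightarrow> nat \<Rightarrow> bool list \<Rightarrow> example_source" where
  "sim_source enc n pk = bind_pmf (bernoulli_pmf (1 / 2))
     (\<lambda>b. map_pmf (\<lambda>x. (pad n x, b)) (encrypt enc n pk b))"

text \<open>The first loop pads the ciphertext to the length counted by 14 but reverses it, and the
  second loop undoes this. The label is copied last because in \<open>Sample\<close> it overwrites
  the instance if both targets coincide.\<close>

definition deliver :: "nat \<Rightarrow> nat \<Rightarrow> prog" where
  "deliver v w = [Copy 14 10, Copy 22 6] @
     [While 14 [Pop 14, Branch (emb 4 0) [Push False 22] [Push False 22] [Push True 22], Pop (emb 4 0)]] @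
     [Copy 26 6] @
     [While 22 [Branch 22 [] [Push False 26] [Push True 26], Pop 22]] @
     [Copy v 26, Copy w 18]"

definition sampler :: "prog \<Rightarrow> nat \<Rightarrow> nat \<Rightarrow> nat \<Rightarrow> prog" where
  "sampler enc B v w = map (\<lambda>i. Copy (emb 4 i) 6) [0..<B] @
     [Copy (emb 4 0) 10, Copy (emb 4 1) 1, Copy 18 6, Flip 18, Copy (emb 4 2) 18] @
     rename (emb 4) enc @ deliver (emb 3 v) (emb 3 w)"

lemma length_unary [simp]: "length (unary n) = n"
  by (simp add: unary_def)

lemma runs_deliver:
  assumes "s 6 = []" "s 10 = unary n" "x = pad n (s (emb 4 0))"
  shows "runs Q (deliver (emb 3 v) (emb 3 w)) s (9 * n + 7)
    (return_pmf (s(14 := [], emb 4 0 := drop n (s (emb 4 0)), 22 := [], 26 := x,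
       emb 3 v := x, emb 3 w := s 18)))"
proof -
  define s1 where "s1 = s(14 := unary n, 22 := [])"
  define s2 where "s2 = s1(14 := [], emb 4 0 := drop n (s (emb 4 0)), 22 := rev x)"
  define s3 where "s3 = s2(26 := [])"
  define s4 where "s4 = s3(22 := [], 26 := x)"
  have 1: "runs Q [Copy 14 10, Copy 22 6] s (Suc (Suc 0)) (return_pmf s1)"
    by (simp add: s1_def assms)
  have 2: "runs Q [While 14 [Pop 14, Branch (emb 4 0) [Push False 22] [Push False 22] [Push True 22],
      Pop (emb 4 0)]] s1 (5 * n + 1) (return_pmf s2)"
    using runs_pad_loop[of 14 "emb 4 0" 22 Q s1] by (simp add: s1_def s2_def assms)
  have 3: "runs Q [Copy 26 6] s2 (Suc 0) (return_pmf s3)"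
    by (simp add: s3_def s2_def s1_def assms)
  have 4: "runs Q [While 22 [Branch 22 [] [Push False 26] [Push True 26], Pop 22]] s3 (4 * n + 1)
      (return_pmf s4)"
    using runs_rev_loop[of 22 26 Q s3] by (simp add: s4_def s3_def s2_def assms)
  have 5: "runs Q [Copy (emb 3 v) 26, Copy (emb 3 w) 18] s4 (Suc (Suc 0))
      (return_pmf (s(14 := [], emb 4 0 := drop n (s (emb 4 0)), 22 := [], 26 := x,
       emb 3 v := x, emb 3 w := s 18)))"
    by (auto simp: s4_def s3_def s2_def s1_def fun_eq_iff)
  have "runs Q (deliver (emb 3 v) (emb 3 w)) s
      (Suc (Suc 0) + (5 * n + 1 + (Suc 0 + (4 * n + 1 + Suc (Suc 0)))))
      (return_pmf (s(14 := [], emb 4 0 := drop n (s (emb 4 0)), 22 := [], 26 := x,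
       emb 3 v := x, emb 3 w := s 18)))"
    unfolding deliver_def by (intro runs_append_return[OF 1] runs_append_return[OF 2]
        runs_append_return[OF 3] runs_append_return[OF 4] 5)
  then show ?thesis by (rule runs_mono) simp
qed

text \<open>Establishes the assumption \<open>blk\<close> of the simulation for the learner. The 12
  consists of five instructions preparing the call of \<open>enc\<close> and the 7 from
  \<open>runs_deliver\<close>; \<open>B\<close> steps clear the encryption block.\<close>

lemma runs_sampler:
  assumes "env n pk ct s" "\<And>b. halts_within no_oracle enc [unary n, pk, [b]] t"
    and "width enc \<le> B" "3 \<le> B" "v < A" "w < A"
  shows "\<exists>M. runs no_oracle (sampler enc B v w) s (B + t + 9 * n + 12) M \<and>
    (\<forall>s' \<in> set_pmf M. env n pk ct s') \<and>
    map_pmf (view (emb 3) A) M =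
      map_pmf (\<lambda>(x, b). (view (emb 3) A s)(v := x, w := [b])) (sim_source enc n pk)"
proof -
  define s1 where "s1 = (\<lambda>j. if j \<in> emb 4 ` {..<B} then [] else s j)"
  define s2 where "s2 = s1(emb 4 0 := unary n, emb 4 1 := pk, 18 := [])"
  define s3 where "s3 b = s2(18 := [b], emb 4 2 := [b])" for b :: bool
  define fin where "fin s' = s'(14 := [], emb 4 0 := drop n (s' (emb 4 0)), 22 := [],
      26 := pad n (s' (emb 4 0)), emb 3 v := pad n (s' (emb 4 0)), emb 3 w := s' 18)" for s' :: state
  have s: "s 1 = pk" "s 2 = ct" "s 6 = []" "s 10 = unary n" "\<And>i. s (emb 5 i) = []"
    using assms(1) by (auto simp: env_def)
  have frame: "i \<notin> emb 4 ` {..<B} \<Longrightarrow> i \<noteq> 18 \<Longrightarrow> s3 b i = s i" for i b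
    using assms(4) by (auto simp: s3_def s2_def s1_def)
  have start: "s3 b (emb 4 i) = (if i < length [unary n, pk, [b]] then [unary n, pk, [b]] ! i else [])"
    if "i < B" for i b
    using that by (auto simp: s3_def s2_def s1_def less_Suc_eq numeral_3_eq_3 numeral_2_eq_2)
  have "\<exists>M. runs no_oracle (rename (emb 4) enc) (s3 b) t M \<and>
      map_pmf (\<lambda>s'. s' (emb 4 0)) M = encrypt enc n pk b \<and>
      (\<forall>s' \<in> set_pmf M. \<forall>i. i \<notin> emb 4 ` {..<B} \<longrightarrow> s' i = s3 b i)" for b
  proof -
    obtain M where "runs no_oracle (rename (emb 4) enc) (s3 b) t M"
      "map_pmf (\<lambda>s'. s' (emb 4 0)) M = map_pmf out_string (outcome no_oracle enc [unary n, pk, [b]])"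
      "\<And>s' i. s' \<in> set_pmf M \<Longrightarrow> i \<notin> emb 4 ` {..<B} \<Longrightarrow> s' i = s3 b i"
      by (rule runs_call[OF assms(2)[of b] assms(3), where f = "emb 4" and s = "s3 b"])
        (use assms(4) start in auto)
    then show ?thesis by (auto simp: encrypt_def)
  qed
  then obtain E where E: "\<And>b. runs no_oracle (rename (emb 4) enc) (s3 b) t (E b)"
      "\<And>b. map_pmf (\<lambda>s'. s' (emb 4 0)) (E b) = encrypt enc n pk b"
      "\<And>b s' i. s' \<in> set_pmf (E b) \<Longrightarrow> i \<notin> emb 4 ` {..<B} \<Longrightarrow> s' i = s3 b i"
    by metis
  have keep: "s' i = s i" if "s' \<in> set_pmf (E b)" "i \<notin> range (emb 4)" "i \<noteq> 18" for s' i b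
    using E(3)[OF that(1), of i] frame[of i b] that(2,3) by auto
  have env': "s' 1 = pk" "s' 2 = ct" "s' 6 = []" "s' 10 = unary n" "\<And>i. s' (emb 5 i) = []"
    "\<And>i. s' (emb 3 i) = s (emb 3 i)" if "s' \<in> set_pmf (E b)" for s' b
    using keep[OF that] s by (auto simp: image_iff)
  \<comment> \<open>Stack 18 lies outside the encryption block, so the coin survives the encryption
    and can be delivered as the label.\<close>
  have s'_18: "s' 18 = [b]" if "s' \<in> set_pmf (E b)" for s' b
    using E(3)[OF that, of 18] by (auto simp: s3_def image_iff)
  have deliver: "runs no_oracle (deliver (emb 3 v) (emb 3 w)) s' (9 * n + 7) (return_pmf (fin s'))"
    if "s' \<in> set_pmf (E b)" for s' b
    unfolding fin_def by (intro runs_deliver env'[OF that] refl)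
  have run: "runs no_oracle (Copy (emb 4 2) 18 # rename (emb 4) enc @ deliver (emb 3 v) (emb 3 w))
      (s2(18 := b # s2 18)) (Suc (t + (9 * n + 7))) (bind_pmf (E b) (\<lambda>s'. return_pmf (fin s')))" for b
  proof -
    have "s2(18 := b # s2 18, emb 4 2 := (s2(18 := b # s2 18)) 18) = s3 b"
      by (simp add: s3_def s2_def)
    then show ?thesis
      using runs_append[OF E(1)[of b] deliver[of _ b]] by (simp only: runs_Copy)
  qed
  define M where "M = bind_pmf (bernoulli_pmf (1 / 2)) (\<lambda>b. map_pmf fin (E b))"
  define u where "u = Suc (Suc (t + (9 * n + 7)))"
  have flip: "runs no_oracle (Flip 18 # Copy (emb 4 2) 18 # rename (emb 4) enc @
      deliver (emb 3 v) (emb 3 w)) s2 u M"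
    using runs_Flip[OF run] by (simp only: M_def map_pmf_def u_def)
  have "runs no_oracle (map (\<lambda>i. Copy (emb 4 i) 6) [0..<B]) s B (return_pmf s1)"
    using runs_clear[of s 6 "emb 4" "[0..<B]" no_oracle] s(3)
    by (simp add: s1_def atLeast0LessThan image_iff)
  then have "runs no_oracle (sampler enc B v w) s
      (B + Suc (Suc (Suc u))) M"
    unfolding sampler_def
  proof (rule runs_append_return)
    have "s1 6 = []" "s1 10 = unary n" "s1 1 = pk"
      using s by (auto simp: s1_def)
    then show "runs no_oracle ([Copy (emb 4 0) 10, Copy (emb 4 1) 1, Copy 18 6, Flip 18,
        Copy (emb 4 2) 18] @ rename (emb 4) enc @ deliver (emb 3 v) (emb 3 w)) s1
        (Suc (Suc (Suc u))) M"
      using flip by (simp add: s2_def u_def [symmetric])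
  qed
  moreover have "env n pk ct s'" if "s' \<in> set_pmf M" for s'
    using that env' by (auto simp: M_def env_def fin_def)
  moreover have "map_pmf (view (emb 3) A) M =
      map_pmf (\<lambda>(x, b). (view (emb 3) A s)(v := x, w := [b])) (sim_source enc n pk)"
  proof -
    have "map_pmf (view (emb 3) A) (map_pmf fin (E b)) =
        map_pmf (\<lambda>x. (view (emb 3) A s)(v := pad n x, w := [b])) (encrypt enc n pk b)" for b
      unfolding E(2)[symmetric] pmf.map_comp
      using assms(5,6) env' s'_18
      by (intro map_pmf_cong refl) (auto simp: view_def fin_def fun_eq_iff)
    then show ?thesis
      by (simp add: M_def sim_source_def map_bind_pmf pmf.map_comp o_def)
  qed
  ultimately show ?thesis
    by (intro exI[of _ M]) (auto simp: u_def elim: runs_mono)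
qed

section \<open>The attacker as a program\<close>

lemma runs_replicate_Push:
  "runs Q (replicate k (Push True v)) s k (return_pmf (s(v := unary k @ s v)))"
proof (induction k arbitrary: s)
  case (Suc k)
  have upd: "(s(v := True # s v))(v := unary k @ (s(v := True # s v)) v) = s(v := unary (Suc k) @ s v)"
    by (auto simp: fun_eq_iff unary_def replicate_app_Cons_same)
  show ?case
    using Suc[of "s(v := True # s v)"] by (simp only: replicate_Suc runs_Push upd)
qed (simp add: unary_def)

text \<open>The learner's three inverse parameters are the same constant \<open>k\<close>, so fixed
  numbers of pushes write them. The final copy puts the evaluator's answer where
  \<open>out_bit\<close> reads it.\<close>

definition attack :: "prog \<Rightarrow> prog \<Rightarrow> prog \<Rightarrow> nat \<Rightarrow> nat \<Rightarrow> prog" where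
  "attack enc A c B k = [Copy (emb 3 0) 10] @
     replicate k (Push True (emb 3 1)) @ replicate k (Push True (emb 3 2)) @
     replicate k (Push True (emb 3 3)) @
     translate (emb 3) (sampler enc B) A @
     [Copy (emb 5 0) (emb 3 0), Copy (emb 5 1) 2] @
     rename (emb 5) c @ [Copy 0 (emb 5 0)]"

text \<open>
  The first loop makes the security parameter unary, since the time bound of an attacker has to hold
  for arbitrary inputs. Security parameter 0 is excluded as the learner may then not halt.
\<close>

definition attacker :: "prog \<Rightarrow> prog \<Rightarrow> prog \<Rightarrow> nat \<Rightarrow> nat \<Rightarrow> prog" where
  "attacker enc A c B k = [While 0 [Pop 0, Push True 10]] @
     [Branch 10 [] (attack enc A c B k) (attack enc A c B k)]"

lemma runs_attack:
  fixes enc A c B k n pk ct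
  defines "Q \<equiv> sim_source enc n pk" and "inp \<equiv> [unary n, unary k, unary k, unary k]"
  assumes "\<And>b. halts_within no_oracle enc [unary n, pk, [b]] te"
    and A: "halts_within Q A inp ta"
    and c: "\<And>h. length h \<le> n + k + 1 + ta \<Longrightarrow> halts_within no_oracle c [h, ct] tc"
    and H: "\<And>h. map_pmf out_bit (outcome no_oracle c [h, ct]) = return_pmf (H h)"
    and B: "width enc \<le> B" "width A \<le> B" "width c \<le> B" "4 \<le> B"
    and s: "env n pk ct s" "\<And>i. s (emb 3 i) = []"
    and Q_cube: "set_pmf Q \<subseteq> cube n \<times> UNIV"
  shows "\<exists>M. runs no_oracle (attack enc A c B k) s
      (1 + 3 * k + (B + te + 9 * n + 12) * ta + 2 + tc + 1) M \<and>
    map_pmf out_bit M = map_pmf H (map_pmf out_string (outcome Q A inp))"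
proof -
  interpret simulation "emb 3" "sampler enc B" B "B + te + 9 * n + 12" Q no_oracle "env n pk ct"
  proof (standard, goal_cases)
    case (3 v w s)
    show ?case unfolding Q_def
      by (rule runs_sampler) (use 3 assms in auto)
  qed (auto simp: env_def)
  define s1 where "s1 = s(emb 3 0 := unary n, emb 3 1 := unary k, emb 3 2 := unary k, emb 3 3 := unary k)"
  have init: "runs no_oracle ([Copy (emb 3 0) 10] @
     replicate k (Push True (emb 3 1)) @ replicate k (Push True (emb 3 2)) @
     replicate k (Push True (emb 3 3))) s (Suc 0 + (k + (k + k))) (return_pmf s1)"
  proof (intro runs_append_return)
    let ?s = "s(emb 3 0 := unary n)"
    show "runs no_oracle [Copy (emb 3 0) 10] s (Suc 0) (return_pmf ?s)"
      using s by (simp add: env_def)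
    show "runs no_oracle (replicate k (Push True (emb 3 1))) ?s k (return_pmf (?s(emb 3 1 := unary k)))"
      using runs_replicate_Push[of no_oracle k "emb 3 1" ?s] s(2) by simp
    show "runs no_oracle (replicate k (Push True (emb 3 2))) (?s(emb 3 1 := unary k)) k
        (return_pmf (?s(emb 3 1 := unary k, emb 3 2 := unary k)))"
      using runs_replicate_Push[of no_oracle k "emb 3 2" "?s(emb 3 1 := unary k)"] s(2) by simp
    show "runs no_oracle (replicate k (Push True (emb 3 3)))
        (?s(emb 3 1 := unary k, emb 3 2 := unary k)) k (return_pmf s1)"
      using runs_replicate_Push[of no_oracle k "emb 3 3" "?s(emb 3 1 := unary k, emb 3 2 := unary k)"] s(2)
      by (simp add: s1_def)
  qed
  have s1: "view (emb 3) B s1 = snd (start A inp)"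
    using B(4) s(2) by (auto simp: view_def start_def s1_def inp_def fun_eq_iff nth_Cons split: nat.splits)
  have "env n pk ct s1"
    using s by (auto simp: env_def s1_def)
  then obtain M where M: "runs no_oracle (translate (emb 3) (sampler enc B) A) s1
      ((B + te + 9 * n + 12) * ta) M"
    "\<And>s'. s' \<in> set_pmf M \<Longrightarrow> env n pk ct s'" "map_pmf (view (emb 3) B) M = outcome Q A inp"
    using simulate[of A s1 ta "outcome Q A inp"] A B(2) s1 by (auto simp: halts_within_iff_runs)
  \<comment> \<open>The inputs have height at most \<open>n + k + 1\<close>, where the 1 makes the
    bound positive as \<open>steps_stack_length\<close> requires; \<open>ta\<close> steps add at
    most \<open>ta\<close>.\<close>
  have len: "length (s' (emb 3 0)) \<le> n + k + 1 + ta" if "s' \<in> set_pmf M" for s'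
  proof -
    have "view (emb 3) B s' \<in> set_pmf (outcome Q A inp)"
      using that by (simp flip: M(3))
    then have "view (emb 3) B s' \<in> set_pmf (map_pmf snd (steps Q ta (start A inp)))"
      using outcome_eq[OF A] by simp
    then obtain q where "(q, view (emb 3) B s') \<in> set_pmf (steps Q ta (A, snd (start A inp)))"
      by (auto simp: start_def)
    from steps_stack_length[OF Q_cube _ _ _ this, of "n + k + 1" 0] show ?thesis
      using B(4) by (auto simp: view_def start_def inp_def nth_Cons split: nat.splits)
  qed
  define s2 where "s2 s' = s'(emb 5 0 := s' (emb 3 0), emb 5 1 := ct)" for s' :: state
  have "\<exists>N. runs no_oracle (rename (emb 5) c) (s2 s') tc N \<and>
      map_pmf (\<lambda>s. s (emb 5 0)) N = map_pmf out_string (outcome no_oracle c [s' (emb 3 0), ct])"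
    if "s' \<in> set_pmf M" for s'
  proof -
    \<comment> \<open>By the invariant, the simulation has left the evaluator's block empty; only
      its two inputs have been written.\<close>
    have "s2 s' (emb 5 i) = (if i < length [s' (emb 3 0), ct] then [s' (emb 3 0), ct] ! i else [])" for i
      using M(2)[OF that] by (auto simp: s2_def env_def less_Suc_eq)
    moreover have "halts_within no_oracle c [s' (emb 3 0), ct] tc"
      by (rule c[OF len[OF that]])
    ultimately obtain N where "runs no_oracle (rename (emb 5) c) (s2 s') tc N"
      "map_pmf (\<lambda>s. s (emb 5 0)) N = map_pmf out_string (outcome no_oracle c [s' (emb 3 0), ct])"
      by (rule_tac runs_call[where f = "emb 5" and s = "s2 s'" and B = B and c = c]) (use B in auto)
    then show ?thesis by blast
  qed
  then obtain N where N: "\<And>s'. s' \<in> set_pmf M \<Longrightarrow> runs no_oracle (rename (emb 5) c) (s2 s') tc (N s')"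
    "\<And>s'. s' \<in> set_pmf M \<Longrightarrow> map_pmf (\<lambda>s. s (emb 5 0)) (N s') =
       map_pmf out_string (outcome no_oracle c [s' (emb 3 0), ct])"
    by metis
  define R where "R = bind_pmf M (\<lambda>s'. map_pmf (\<lambda>s. s(0 := s (emb 5 0))) (N s'))"
  have "runs no_oracle (([Copy (emb 3 0) 10] @
     replicate k (Push True (emb 3 1)) @ replicate k (Push True (emb 3 2)) @
     replicate k (Push True (emb 3 3))) @ (translate (emb 3) (sampler enc B) A @
     [Copy (emb 5 0) (emb 3 0), Copy (emb 5 1) 2] @
     rename (emb 5) c @ [Copy 0 (emb 5 0)])) s
     (Suc 0 + (k + (k + k)) + ((B + te + 9 * n + 12) * ta + (Suc (Suc (tc + Suc 0))))) R"
    unfolding R_def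
  proof (intro runs_append_return[OF init] runs_append[OF M(1)])
    fix s' assume s': "s' \<in> set_pmf M"
    have "runs no_oracle (rename (emb 5) c @ [Copy 0 (emb 5 0)]) (s2 s') (tc + Suc 0)
       (bind_pmf (N s') (\<lambda>s. return_pmf (s(0 := s (emb 5 0)))))"
      by (intro runs_append N(1)[OF s']) simp
    then show "runs no_oracle ([Copy (emb 5 0) (emb 3 0), Copy (emb 5 1) 2] @
       rename (emb 5) c @ [Copy 0 (emb 5 0)]) s' (Suc (Suc (tc + Suc 0)))
       (map_pmf (\<lambda>s. s(0 := s (emb 5 0))) (N s'))"
      using M(2)[OF s'] by (simp add: s2_def env_def map_pmf_def)
  qed
  then have "runs no_oracle (attack enc A c B k) s
      (1 + 3 * k + (B + te + 9 * n + 12) * ta + 2 + tc + 1) R"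
    unfolding attack_def by (auto elim: runs_mono)
  moreover have "map_pmf out_bit R = map_pmf H (map_pmf out_string (outcome Q A inp))"
  proof -
    have "map_pmf out_bit (map_pmf (\<lambda>s. s(0 := s (emb 5 0))) (N s')) = return_pmf (H (s' (emb 3 0)))"
      if "s' \<in> set_pmf M" for s'
    proof -
      have "map_pmf out_bit (map_pmf (\<lambda>s. s(0 := s (emb 5 0))) (N s')) =
          map_pmf (\<lambda>y. y = [True]) (map_pmf (\<lambda>s. s (emb 5 0)) (N s'))"
        by (simp add: pmf.map_comp o_def out_bit_def)
      also have "\<dots> = map_pmf out_bit (outcome no_oracle c [s' (emb 3 0), ct])"
        unfolding N(2)[OF that] by (simp add: pmf.map_comp o_def out_bit_def [abs_def] out_string_def)
      finally show ?thesis by (simp add: H)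
    qed
    then have "map_pmf out_bit R = map_pmf (\<lambda>s'. H (s' (emb 3 0))) M"
      unfolding R_def map_bind_pmf map_pmf_def[of "\<lambda>s'. H (s' (emb 3 0))"]
      by (intro bind_pmf_cong) auto
    also have "\<dots> = map_pmf H (map_pmf out_string (map_pmf (view (emb 3) B) M))"
      using B(4) by (simp add: pmf.map_comp o_def out_string_def view_def)
    finally show ?thesis unfolding M(3) .
  qed
  ultimately show ?thesis by blast
qed

lemma halts_within_mono: "halts_within Q c xs t \<Longrightarrow> t \<le> u \<Longrightarrow> halts_within Q c xs u"
  by (auto simp: halts_within_iff_runs intro: runs_mono)

lemma set_sim_source: "set_pmf (sim_source enc n pk) \<subseteq> cube n \<times> UNIV"
  by (auto simp: sim_source_def cube_def)

lemma halts_within_attacker_Nil: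
  "halts_within no_oracle (attacker enc A c B k) [[], pk, ct] (Suc (Suc 0))"
  by (rule runs_halts_within) (simp add: attacker_def start_def)

lemma runs_attacker:
  fixes enc A c :: prog and B k :: nat and x pk ct :: "bool list"
  defines "n \<equiv> length x"
  defines "Q \<equiv> sim_source enc n pk" and "inp \<equiv> [unary n, unary k, unary k, unary k]"
  assumes "x \<noteq> []" "\<And>b. halts_within no_oracle enc [unary n, pk, [b]] te"
    and "halts_within Q A inp ta"
    and "\<And>h. length h \<le> n + k + 1 + ta \<Longrightarrow> halts_within no_oracle c [h, ct] tc"
    and "\<And>h. map_pmf out_bit (outcome no_oracle c [h, ct]) = return_pmf (H h)"
    and "width enc \<le> B" "width A \<le> B" "width c \<le> B" "4 \<le> B"
  shows "\<exists>M. runs no_oracle (attacker enc A c B k) (snd (start (attacker enc A c B k) [x, pk, ct]))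
      (3 * n + 1 + (1 + (1 + 3 * k + (B + te + 9 * n + 12) * ta + 2 + tc + 1))) M \<and>
    map_pmf out_bit M = map_pmf H (map_pmf out_string (outcome Q A inp))"
proof -
  define s0 where "s0 = snd (start (attacker enc A c B k) [x, pk, ct])"
  define s1 where "s1 = s0(0 := [], 10 := unary n)"
  have s0: "s0 0 = x" "s0 1 = pk" "s0 2 = ct" "\<And>i. 3 \<le> i \<Longrightarrow> s0 i = []"
    by (auto simp: s0_def start_def)
  have init: "runs no_oracle [While 0 [Pop 0, Push True 10]] s0 (3 * n + 1) (return_pmf s1)"
    using runs_unary_loop[of 0 10 no_oracle s0] by (simp add: s1_def s0 n_def)
  have "3 \<le> emb 3 i" "3 \<le> emb 5 i" for i
    by (auto simp: emb_def)
  with s0 have s1: "env n pk ct s1" "\<And>i. s1 (emb 3 i) = []"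
    by (auto simp: env_def s1_def)
  obtain M where M: "runs no_oracle (attack enc A c B k) s1
      (1 + 3 * k + (B + te + 9 * n + 12) * ta + 2 + tc + 1) M"
    "map_pmf out_bit M = map_pmf H (map_pmf out_string (outcome Q A inp))"
    unfolding Q_def inp_def
    using runs_attack[OF assms(5-12)[unfolded Q_def inp_def] s1 set_sim_source] by auto
  obtain bs where "s1 10 = True # bs"
    using \<open>x \<noteq> []\<close> by (cases x) (auto simp: s1_def n_def unary_def)
  then have "runs no_oracle [Branch 10 [] (attack enc A c B k) (attack enc A c B k)] s1
      (Suc (1 + 3 * k + (B + te + 9 * n + 12) * ta + 2 + tc + 1)) M"
    using M(1) by (simp only: runs_Branch) simp
  from runs_append_return[OF init this] M(2) show ?thesis
    by (intro exI[of _ M]) (simp add: attacker_def s0_def)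
qed

text \<open>The time bound must be one polynomial in the total input length, valid also for
  malformed keys and challenges. Padding in \<open>sim_source\<close> makes the learner's bound
  applicable to every public key.\<close>

lemma attacker_ppt:
  assumes "ppt 3 enc" "ppt 2 c"
    and H: "\<And>h x. map_pmf out_bit (outcome no_oracle c [h, x]) = return_pmf (H h x)"
    and A: "\<And>n Q. 0 < n \<Longrightarrow> set_pmf Q \<subseteq> cube n \<times> UNIV \<Longrightarrow>
      halts_within Q A [unary n, unary k, unary k, unary k] (poly pa n)"
  obtains D where "ppt 3 D"
    "\<And>n pk ct. 0 < n \<Longrightarrow> map_pmf out_bit (outcome no_oracle D [unary n, pk, ct]) =
       map_pmf (\<lambda>h. H h ct) (map_pmf out_string
         (outcome (sim_source enc n pk) A [unary n, unary k, unary k, unary k]))"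
proof -
  define B where "B = width enc + width A + width c + 4"
  define D where "D = attacker enc A c B k"
  from assms(1) obtain pe where pe: "\<And>xs. length xs = 3 \<Longrightarrow>
      halts_within no_oracle enc xs (poly pe (sum_list (map length xs)))"
    by (auto simp: ppt_def)
  from assms(2) obtain pc where pc: "\<And>xs. length xs = 2 \<Longrightarrow>
      halts_within no_oracle c xs (poly pc (sum_list (map length xs)))"
    by (auto simp: ppt_def)
  \<comment> \<open>All lengths are estimated by the total length \<open>N\<close>: the input of
    \<open>enc\<close> by \<open>N + 1\<close>, the 1 being the message bit, and that of the
    evaluator by \<open>N + k + 1 + poly pa N\<close> for the hypothesis plus \<open>N\<close> for
    the challenge.\<close>
  define T where "T = (\<lambda>N. 3 * N + 1 + (1 + (1 + 3 * k + (B + poly pe (N + 1) + 9 * N + 12) * poly pa N + 2 +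
      poly pc (N + k + 1 + poly pa N + N) + 1)))"
  have main: "\<exists>M. runs no_oracle D (snd (start D [x, pk, ct])) (T (length x + length pk + length ct)) M \<and>
      map_pmf out_bit M = map_pmf (\<lambda>h. H h ct) (map_pmf out_string
         (outcome (sim_source enc (length x) pk) A [unary (length x), unary k, unary k, unary k]))"
    if "x \<noteq> []" for x pk ct
  proof -
    define n where "n = length x"
    define N where "N = length x + length pk + length ct"
    have n: "0 < n" "n \<le> N" using that by (auto simp: n_def N_def)
    have "\<exists>M. runs no_oracle (attacker enc A c B k) (snd (start (attacker enc A c B k) [x, pk, ct]))
      (3 * n + 1 + (1 + (1 + 3 * k + (B + poly pe (N + 1) + 9 * n + 12) * poly pa N + 2 +
        poly pc (N + k + 1 + poly pa N + N) + 1))) M \<and>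
      map_pmf out_bit M = map_pmf (\<lambda>h. H h ct) (map_pmf out_string
        (outcome (sim_source enc n pk) A [unary n, unary k, unary k, unary k]))"
      unfolding n_def
    proof (rule runs_attacker)
      show "halts_within no_oracle enc [unary (length x), pk, [b]] (poly pe (N + 1))" for b
        by (rule halts_within_mono[OF pe]) (auto intro!: poly_mono_nat simp: N_def)
      show "halts_within (sim_source enc (length x) pk) A
          [unary (length x), unary k, unary k, unary k] (poly pa N)"
        using A[OF n(1) set_sim_source] n(2)
        by (auto simp: n_def intro: halts_within_mono poly_mono_nat)
      show "halts_within no_oracle c [h, ct] (poly pc (N + k + 1 + poly pa N + N))"
        if "length h \<le> length x + k + 1 + poly pa N" for h
        by (rule halts_within_mono[OF pc]) (use that in \<open>auto intro!: poly_mono_nat simp: N_def\<close>)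
    qed (use that H in \<open>auto simp: B_def\<close>)
    then obtain M where M: "runs no_oracle D (snd (start D [x, pk, ct]))
      (3 * n + 1 + (1 + (1 + 3 * k + (B + poly pe (N + 1) + 9 * n + 12) * poly pa N + 2 +
        poly pc (N + k + 1 + poly pa N + N) + 1))) M"
      "map_pmf out_bit M = map_pmf (\<lambda>h. H h ct) (map_pmf out_string
        (outcome (sim_source enc n pk) A [unary n, unary k, unary k, unary k]))"
      unfolding D_def by blast
    have "3 * n + 1 + (1 + (1 + 3 * k + (B + poly pe (N + 1) + 9 * n + 12) * poly pa N + 2 +
        poly pc (N + k + 1 + poly pa N + N) + 1)) \<le> T N"
      unfolding T_def using n(2) by (intro add_mono mult_mono le_refl) auto
    from runs_mono[OF M(1) this] M(2) show ?thesis
      unfolding n_def N_def by blast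
  qed
  show ?thesis
  proof
    define p where "p = [:3 * k + 6, 3:] + ([:B + 12, 9:] + pcompose pe [:1, 1:]) * pa +
      pcompose pc ([:k + 1, 2:] + pa)"
    have T: "T N = poly p N" for N
      by (simp add: T_def p_def poly_pcompose algebra_simps)
    have "halts_within no_oracle D xs (poly p (sum_list (map length xs)))" if "length xs = 3" for xs
    proof -
      from that obtain x pk ct where xs: "xs = [x, pk, ct]"
        by (auto simp: numeral_3_eq_3 length_Suc_conv)
      show ?thesis
      proof (cases "x = []")
        case True
        have "Suc (Suc 0) \<le> poly p (sum_list (map length xs))"
          by (simp add: T_def flip: T)
        with True show ?thesis
          unfolding xs D_def by (auto intro: halts_within_mono[OF halts_within_attacker_Nil])
      next
        case False
        from main[OF this, of pk ct] show ?thesis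
          by (auto simp: xs T add.assoc intro: runs_halts_within)
      qed
    qed
    then show "ppt 3 D"
      by (auto simp: ppt_def)
  next
    fix n :: nat and pk ct assume "0 < n"
    then have "unary n \<noteq> []" by (auto simp: unary_def)
    from main[OF this, of pk ct] show "map_pmf out_bit (outcome no_oracle D [unary n, pk, ct]) =
       map_pmf (\<lambda>h. H h ct) (map_pmf out_string
         (outcome (sim_source enc n pk) A [unary n, unary k, unary k, unary k]))"
      using runs_outcome by fastforce
  qed
qed

section \<open>The advantage of the attacker\<close>

lemma prob_bind_pmf:
  "measure_pmf.prob (bind_pmf M f) E = measure_pmf.expectation M (\<lambda>x. measure_pmf.prob (f x) E)"
proof -
  have "measure_pmf.prob (bind_pmf M f) E = pmf (map_pmf (\<lambda>x. x \<in> E) (bind_pmf M f)) True"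
    by (simp add: pmf_map vimage_def)
  also have "\<dots> = measure_pmf.expectation M (\<lambda>x. measure_pmf.prob (f x) E)"
    by (simp add: map_bind_pmf pmf_bind pmf_map vimage_def)
  finally show ?thesis .
qed

lemma integrable_pmf_bounded:
  fixes g :: "'a \<Rightarrow> real"
  assumes "\<And>x. \<bar>g x\<bar> \<le> b"
  shows "integrable (measure_pmf M) g"
  using assms by (intro measure_pmf.integrable_const_bound[where B = b]) auto

lemma integrable_prob [simp]: "integrable (measure_pmf M) (\<lambda>x. measure_pmf.prob (f x) E)"
  by (rule integrable_pmf_bounded[where b = 1]) simp

lemma expectation_le:
  fixes g h :: "'a \<Rightarrow> real"
  assumes "integrable (measure_pmf M) g" "integrable (measure_pmf M) h"
    and "\<And>x. x \<in> set_pmf M \<Longrightarrow> g x \<le> h x"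
  shows "measure_pmf.expectation M g \<le> measure_pmf.expectation M h"
  using assms by (intro integral_mono_AE) (auto simp: AE_measure_pmf_iff)

text \<open>Both expectations live on the common space \<open>J\<close>, where the integrands agree
  unless \<open>u\<close> and \<open>v\<close> differ, and then differ by at most 1.\<close>

lemma expectation_diff_coupling:
  fixes g :: "'a \<Rightarrow> real"
  assumes "\<And>x. 0 \<le> g x" "\<And>x. g x \<le> 1"
  shows "\<bar>measure_pmf.expectation (map_pmf u J) g - measure_pmf.expectation (map_pmf v J) g\<bar>
    \<le> measure_pmf.prob J {z. u z \<noteq> v z}"
proof -
  have int: "integrable (measure_pmf J) (\<lambda>z. g (w z))" for w :: "_ \<Rightarrow> 'a"
    by (rule integrable_pmf_bounded[where b = 1]) (use assms in \<open>auto simp: abs_le_iff intro: order_trans[of _ 0]\<close>)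
  have "measure_pmf.expectation (map_pmf u J) g - measure_pmf.expectation (map_pmf v J) g =
      measure_pmf.expectation J (\<lambda>z. g (u z) - g (v z))"
    using int by (subst Bochner_Integration.integral_diff) auto
  also have "\<bar>\<dots>\<bar> \<le> measure_pmf.expectation J (\<lambda>z. \<bar>g (u z) - g (v z)\<bar>)"
    by (rule integral_abs_bound)
  also have "\<dots> \<le> measure_pmf.expectation J (\<lambda>z. indicator {z. u z \<noteq> v z} z)"
  proof (rule expectation_le)
    fix z
    have "\<bar>g (u z) - g (v z)\<bar> \<le> 1"
      using assms[of "u z"] assms[of "v z"] by (simp add: abs_le_iff)
    then show "\<bar>g (u z) - g (v z)\<bar> \<le> indicator {z. u z \<noteq> v z} z"
      by (auto simp: indicator_def)
  qed (use int in \<open>auto intro!: integrable_real_indicator simp: measure_pmf.emeasure_eq_measure\<close>)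
  finally show ?thesis by simp
qed

text \<open>A hybrid argument: exchanging the source in a single step costs at most
  \<open>d\<close>, since a step draws at most one example, and the costs add up over
  \<open>t\<close> steps.\<close>

lemma steps_source_change:
  assumes "Q1 = map_pmf u J" "Q2 = map_pmf v J" "measure_pmf.prob J {z. u z \<noteq> v z} \<le> d"
  shows "\<bar>measure_pmf.prob (steps Q1 t cf) E - measure_pmf.prob (steps Q2 t cf) E\<bar> \<le> real t * d"
proof (induction t arbitrary: cf)
  case 0
  then show ?case by simp
next
  case (Suc t)
  let ?p = "\<lambda>Q cf. measure_pmf.prob (steps Q t cf) E"
  have d: "0 \<le> d" using assms(3) measure_nonneg order_trans by blast
  have "\<bar>measure_pmf.expectation (step Q1 cf) (?p Q1) - measure_pmf.expectation (step Q1 cf) (?p Q2)\<bar> \<le>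
      measure_pmf.expectation (step Q1 cf) (\<lambda>cf. \<bar>?p Q1 cf - ?p Q2 cf\<bar>)"
    unfolding Bochner_Integration.integral_diff[OF integrable_prob integrable_prob, symmetric]
    by (rule integral_abs_bound)
  also have "\<dots> \<le> measure_pmf.expectation (step Q1 cf) (\<lambda>_. real t * d)"
    using Suc by (intro expectation_le integrable_abs) auto
  finally have 1: "\<bar>measure_pmf.expectation (step Q1 cf) (?p Q1) -
      measure_pmf.expectation (step Q1 cf) (?p Q2)\<bar> \<le> real t * d"
    by simp
  \<comment> \<open>The tail now uses \<open>Q2\<close> on both sides, so only the first step is
    exchanged; \<open>expectation_diff_coupling\<close> applies with the acceptance probability of
    the tail as the integrand.\<close>
  have 2: "\<bar>measure_pmf.expectation (step Q1 cf) (?p Q2) - measure_pmf.expectation (step Q2 cf) (?p Q2)\<bar> \<le> d"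
  proof (cases "\<exists>w1 w2 k s. cf = (Sample w1 w2 # k, s)")
    case True
    then obtain w1 w2 k s where cf: "cf = (Sample w1 w2 # k, s)" by blast
    let ?g = "\<lambda>xb. ?p Q2 (case xb of (x, b) \<Rightarrow> (k, s(w1 := x, w2 := [b])))"
    have "\<bar>measure_pmf.expectation Q1 ?g - measure_pmf.expectation Q2 ?g\<bar> \<le> measure_pmf.prob J {z. u z \<noteq> v z}"
      unfolding assms(1,2) by (rule expectation_diff_coupling) auto
    with assms(3) show ?thesis by (simp add: cf)
  next
    case False
    then have "step Q1 cf = step Q2 cf"
      by (cases "(Q1, cf)" rule: step.cases) auto
    with d show ?thesis by simp
  qed
  from 1 2 show ?case
    by (simp add: prob_bind_pmf algebra_simps)
qed

text \<open>Points with \<open>g x\<close> at most \<open>a\<close> contribute at most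
  \<open>a\<close>, and all others at most their probability.\<close>

lemma expectation_le_markov:
  fixes g :: "'a \<Rightarrow> real"
  assumes "\<And>x. 0 \<le> g x" "\<And>x. g x \<le> 1" "0 \<le> a"
  shows "measure_pmf.expectation M g \<le> a + (1 - measure_pmf.prob M {x. g x \<le> a})"
proof -
  have int: "integrable (measure_pmf M) g" "integrable (measure_pmf M) (\<lambda>x. indicator {x. \<not> g x \<le> a} x :: real)"
    by (rule integrable_pmf_bounded[where b = 1]; use assms in \<open>auto simp: abs_le_iff intro: order_trans[of _ 0]\<close>)+
  have "measure_pmf.expectation M g \<le> measure_pmf.expectation M (\<lambda>x. a + indicator {x. \<not> g x \<le> a} x)"
  proof (rule expectation_le)
    show "g x \<le> a + indicator {x. \<not> g x \<le> a} x" for x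
      using assms(2)[of x] assms(3) by (auto simp: indicator_def)
  qed (use int in auto)
  also have "\<dots> = a + measure_pmf.prob M {x. \<not> g x \<le> a}"
    using int(2) by (subst Bochner_Integration.integral_add) auto
  also have "measure_pmf.prob M {x. \<not> g x \<le> a} = 1 - measure_pmf.prob M {x. g x \<le> a}"
    using measure_pmf.prob_compl[of "{x. g x \<le> a}" M] by (simp add: Compl_eq_Diff_UNIV[symmetric] Collect_neg_eq)
  finally show ?thesis .
qed

text \<open>The losses are \<open>a\<close> for runs with a poor hypothesis, \<open>a\<close> for
  the error of a good one, \<open>t * d\<close> for exchanging the examples during learning, and a
  last \<open>d\<close> for testing against the label \<open>b\<close> instead of
  \<open>f x\<close>.\<close>

lemma hypothesis_error_bound:
  fixes H :: "bool list \<Rightarrow> bool list \<Rightarrow> bool" and Q :: example_source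
  assumes d: "measure_pmf.prob Q {(x, b). f x \<noteq> b} \<le> d"
    and t: "halts_within Q A inp t" "halts_within (EX_oracle f (map_pmf fst Q)) A inp t"
    and good: "measure_pmf.prob (map_pmf out_string (outcome (EX_oracle f (map_pmf fst Q)) A inp))
      {h. measure_pmf.prob (map_pmf fst Q) {x. H h x \<noteq> f x} \<le> a} \<ge> 1 - a" and "0 \<le> a"
  shows "measure_pmf.prob (bind_pmf (map_pmf out_string (outcome Q A inp)) (\<lambda>h.
    map_pmf (\<lambda>(x, b). H h x \<noteq> b) Q)) {b. b} \<le> 2 * a + (real t + 1) * d"
proof -
  define err where "err h = measure_pmf.prob (map_pmf fst Q) {x. H h x \<noteq> f x}" for h
  define G where "G = {h. err h \<le> a}"
  let ?O = "map_pmf out_string (outcome Q A inp)"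
  let ?O' = "map_pmf out_string (outcome (EX_oracle f (map_pmf fst Q)) A inp)"
  have "\<bar>measure_pmf.prob (steps Q t (start A inp)) ((out_string \<circ> snd) -` G) -
      measure_pmf.prob (steps (EX_oracle f (map_pmf fst Q)) t (start A inp)) ((out_string \<circ> snd) -` G)\<bar>
      \<le> real t * d"
  proof (rule steps_source_change)
    show "Q = map_pmf (\<lambda>z. z) Q" by simp
    \<comment> \<open>An honest example arises from a simulated one by relabelling its instance with
      \<open>f\<close>, so the coupling is \<open>Q\<close> itself.\<close>
    show "EX_oracle f (map_pmf fst Q) = map_pmf (\<lambda>z. (fst z, f (fst z))) Q"
      by (simp add: EX_oracle_def pmf.map_comp o_def)
    have "{z. z \<noteq> (fst z, f (fst z))} = {(x, b). f x \<noteq> b}" by auto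
    with d show "measure_pmf.prob Q {z. z \<noteq> (fst z, f (fst z))} \<le> d" by simp
  qed
  then have "measure_pmf.prob ?O' G - measure_pmf.prob ?O G \<le> real t * d"
    unfolding outcome_eq[OF t(1)] outcome_eq[OF t(2)]
    by (simp add: pmf.map_comp o_def vimage_def)
  then have G: "measure_pmf.prob ?O G \<ge> 1 - a - real t * d"
    using good unfolding G_def err_def by linarith
  have err_int: "integrable (measure_pmf M) err" for M
    by (rule integrable_pmf_bounded[where b = 1]) (simp add: err_def)
  have "measure_pmf.prob (map_pmf (\<lambda>(x, b). H h x \<noteq> b) Q) {b. b} \<le> err h + d" for h
  proof -
    have "measure_pmf.prob (map_pmf (\<lambda>(x, b). H h x \<noteq> b) Q) {b. b} =
        measure_pmf.prob Q {(x, b). H h x \<noteq> b}"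
      by (simp add: vimage_def case_prod_unfold)
    also have "\<dots> \<le> measure_pmf.prob Q ({(x, b). H h x \<noteq> f x} \<union> {(x, b). f x \<noteq> b})"
      by (rule measure_pmf.finite_measure_mono) auto
    also have "\<dots> \<le> measure_pmf.prob Q {(x, b). H h x \<noteq> f x} + measure_pmf.prob Q {(x, b). f x \<noteq> b}"
      by (rule measure_Un_le) auto
    also have "measure_pmf.prob Q {(x, b). H h x \<noteq> f x} = err h"
      by (simp add: err_def vimage_def case_prod_unfold)
    finally show ?thesis using d by simp
  qed
  then have "measure_pmf.prob (bind_pmf ?O (\<lambda>h. map_pmf (\<lambda>(x, b). H h x \<noteq> b) Q)) {b. b}
      \<le> measure_pmf.expectation ?O (\<lambda>h. err h + d)"
    unfolding prob_bind_pmf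
    by (intro expectation_le integrable_prob Bochner_Integration.integrable_add err_int) auto
  also have "\<dots> = measure_pmf.expectation ?O err + d"
    using err_int by (subst Bochner_Integration.integral_add) auto
  also have "measure_pmf.expectation ?O err \<le> a + (1 - measure_pmf.prob ?O G)"
    unfolding G_def by (rule expectation_le_markov) (auto simp: err_def \<open>0 \<le> a\<close>)
  finally show ?thesis
    using G by (simp add: algebra_simps)
qed

section \<open>From predicting a random bit to distinguishing\<close>

lemma Collect_bool: "{z. z} = {True}" "{z. \<not> z} = {False}"
  by auto

text \<open>The test example is independent of the hypothesis, so the order of drawing them can be
  exchanged; conditioning on the bit then gives one half of (1 - advantage).\<close>

lemma guessing_probability:
  fixes E :: "bool \<Rightarrow> 'c pmf" and L :: "'h pmf" and H :: "'h \<Rightarrow> 'c \<Rightarrow> bool"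
  defines "a \<equiv> \<lambda>y. measure_pmf.prob (bind_pmf (E y) (\<lambda>c. map_pmf (\<lambda>h. H h c) L)) {b. b}"
  shows "measure_pmf.prob (bind_pmf L (\<lambda>h. map_pmf (\<lambda>(x, b). H h x \<noteq> b)
      (bind_pmf (bernoulli_pmf (1 / 2)) (\<lambda>b. map_pmf (\<lambda>x. (x, b)) (E b))))) {b. b} =
    (1 - a True) / 2 + a False / 2"
proof -
  define W where "W y = bind_pmf (E y) (\<lambda>c. map_pmf (\<lambda>h. H h c) L)" for y
  have "bind_pmf L (\<lambda>h. map_pmf (\<lambda>(x, b). H h x \<noteq> b)
      (bind_pmf (bernoulli_pmf (1 / 2)) (\<lambda>b. map_pmf (\<lambda>x. (x, b)) (E b)))) =
      bind_pmf L (\<lambda>h. bind_pmf (bernoulli_pmf (1 / 2)) (\<lambda>b. map_pmf (\<lambda>x. H h x \<noteq> b) (E b)))"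
    by (simp add: map_bind_pmf pmf.map_comp o_def)
  also have "\<dots> = bind_pmf (bernoulli_pmf (1 / 2)) (\<lambda>b. bind_pmf (E b) (\<lambda>x. map_pmf (\<lambda>h. H h x \<noteq> b) L))"
    unfolding map_pmf_def by (subst bind_commute_pmf, subst (2) bind_commute_pmf) simp
  also have "\<dots> = bind_pmf (bernoulli_pmf (1 / 2)) (\<lambda>b. map_pmf (\<lambda>z. z \<noteq> b) (W b))"
    by (simp add: W_def map_bind_pmf pmf.map_comp o_def)
  finally have "measure_pmf.prob (bind_pmf L (\<lambda>h. map_pmf (\<lambda>(x, b). H h x \<noteq> b)
      (bind_pmf (bernoulli_pmf (1 / 2)) (\<lambda>b. map_pmf (\<lambda>x. (x, b)) (E b))))) {b. b} =
      measure_pmf.prob (W True) {z. \<not> z} / 2 + measure_pmf.prob (W False) {z. z} / 2"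
    by (simp add: prob_bind_pmf[of "bernoulli_pmf _"] vimage_def) (simp add: Collect_bool)
  moreover have "measure_pmf.prob (W True) {z. \<not> z} = 1 - measure_pmf.prob (W True) {z. z}"
    using measure_pmf.prob_compl[of "{z. z}" "W True"] by (simp add: Compl_eq_Diff_UNIV[symmetric] Collect_neg_eq)
  ultimately show ?thesis
    by (simp add: a_def W_def)
qed

section \<open>Negligible functions\<close>

lemma poly_le_monomial: "\<exists>C d. \<forall>n \<ge> 1. poly (p :: nat poly) n \<le> C * n ^ d"
proof (induction p)
  case 0
  show ?case by auto
next
  case (pCons a p)
  then obtain C d where C: "\<And>n. n \<ge> 1 \<Longrightarrow> poly p n \<le> C * n ^ d" by blast
  have "poly (pCons a p) n \<le> (a + C) * n ^ Suc d" if "n \<ge> 1" for n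
  proof -
    have "1 \<le> n ^ Suc d"
      using that by (rule one_le_power)
    from mult_le_mono2[OF this, of a] have "a \<le> a * n ^ Suc d"
      by simp
    moreover have "n * poly p n \<le> C * n ^ Suc d"
      using mult_le_mono2[OF C[OF that], of n] by (simp add: ac_simps)
    ultimately show ?thesis
      by (simp only: poly_pCons add_mult_distrib add_mono)
  qed
  then show ?case by blast
qed

text \<open>If the polynomial is at most C n^d, an exponent \<open>w n\<close> of at least d + 1
  leaves C / n, which is at most \<gamma> as soon as n is at least C / \<gamma>.\<close>

lemma negligible_times_poly:
  fixes p :: "nat poly" and w :: "nat \<Rightarrow> real"
  assumes "filterlim w at_top sequentially" "0 < \<gamma>"
  shows "\<forall>\<^sub>F n in sequentially. real (poly p n) * (1 / real n powr w n) \<le> \<gamma>"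
proof -
  obtain C d where C: "\<And>n. n \<ge> 1 \<Longrightarrow> poly p n \<le> C * n ^ d"
    using poly_le_monomial by blast
  have "\<forall>\<^sub>F n in sequentially. real (Suc d) \<le> w n"
    using assms(1) by (simp add: filterlim_at_top)
  moreover have "\<forall>\<^sub>F n in sequentially. n \<ge> max 1 (nat \<lceil>real C / \<gamma>\<rceil>)"
    by (rule eventually_ge_at_top)
  ultimately show ?thesis
  proof eventually_elim
    case (elim n)
    then have n: "n \<ge> 1" "real C / \<gamma> \<le> real n" by linarith+
    have "real (poly p n) * (1 / real n powr w n) \<le> real (C * n ^ d) * (1 / real n powr real (Suc d))"
      using n elim C[OF n(1)]
      by (intro mult_mono divide_left_mono powr_mono mult_pos_pos) (auto simp flip: of_nat_mult of_nat_power)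
    also have "\<dots> = real C / real n"
      using n(1) by (subst powr_realpow) (auto simp: field_simps)
    also have "\<dots> \<le> \<gamma>"
      using n \<open>0 < \<gamma>\<close> by (simp add: field_simps)
    finally show ?case .
  qed
qed

section \<open>Averaging over key pairs\<close>

lemma prob_split:
  "measure_pmf.prob (do {(a, b) \<leftarrow> M; f a b}) E = measure_pmf.expectation M (\<lambda>(a, b). measure_pmf.prob (f a b) E)"
  unfolding prob_bind_pmf by (simp add: case_prod_unfold)

text \<open>For each key pair the guessing error is at most 1 if the key is bad and is otherwise
  bounded by \<open>hypothesis_error_bound\<close>. Averaging gives
  \<open>3 * a + (t + 1) * \<gamma>\<close>, and solving error = (1 - advantage) / 2 for the
  advantage doubles these terms.\<close>

lemma attacker_advantage:
  fixes gen enc D A :: prog and n k t :: nat and inp :: "bool list list" and a \<gamma> :: real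
  defines "L \<equiv> \<lambda>pk. map_pmf out_string (outcome (sim_source enc n pk) A inp)"
  assumes cube: "\<And>sk pk y. (sk, pk) \<in> set_pmf (keypair gen n) \<Longrightarrow> set_pmf (encrypt enc n pk y) \<subseteq> cube n"
    and err: "\<And>y. decryption_error gen enc dec n y \<le> \<gamma>"
    and t: "\<And>Q. set_pmf Q \<subseteq> cube n \<times> UNIV \<Longrightarrow> halts_within Q A inp t"
    and D: "\<And>pk ct. map_pmf out_bit (outcome no_oracle D [unary n, pk, ct]) = map_pmf (\<lambda>h. H h ct) (L pk)"
    and learn: "measure_pmf.prob (dec_distribution gen dec n) {f. \<forall>\<rho>. set_pmf \<rho> \<subseteq> cube n \<longrightarrow>
           measure_pmf.prob (map_pmf out_string (outcome (EX_oracle f \<rho>) A inp))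
             {h. measure_pmf.prob \<rho> {x. H h x \<noteq> f x} \<le> a} \<ge> 1 - a} \<ge> 1 - a"
    and "0 \<le> a"
  shows "accept_prob gen enc D n True - accept_prob gen enc D n False \<ge> 1 - 6 * a - 2 * (real t + 1) * \<gamma>"
proof -
  define K where "K = keypair gen n"
  define S where "S = {f. \<forall>\<rho>. set_pmf \<rho> \<subseteq> cube n \<longrightarrow>
           measure_pmf.prob (map_pmf out_string (outcome (EX_oracle f \<rho>) A inp))
             {h. measure_pmf.prob \<rho> {x. H h x \<noteq> f x} \<le> a} \<ge> 1 - a}"
  define acc where "acc y pk = measure_pmf.prob
      (bind_pmf (encrypt enc n pk y) (\<lambda>c. map_pmf (\<lambda>h. H h c) (L pk))) {b. b}" for y pk
  define err where "err y sk pk = measure_pmf.prob (encrypt enc n pk y) {c. dec sk c \<noteq> y}" for y sk pk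
  define bad where "bad = {(sk, pk :: bool list). dec_fun dec n sk \<notin> S}"
  have int: "integrable (measure_pmf K) (\<lambda>(sk, pk). acc y pk)" "integrable (measure_pmf K) (\<lambda>(sk, pk). err y sk pk)" for y
    by (auto intro!: integrable_pmf_bounded[where b = 1] simp: acc_def err_def)
  have int_bad: "integrable (measure_pmf K) (indicator bad :: _ \<Rightarrow> real)"
    by (rule integrable_pmf_bounded[where b = 1]) (simp add: indicator_def)
  have acc: "accept_prob gen enc D n y = measure_pmf.expectation K (\<lambda>(sk, pk). acc y pk)" for y
    unfolding accept_prob_def prob_split D acc_def K_def ..
  have "measure_pmf.expectation K (\<lambda>(sk, pk). err y sk pk) = decryption_error gen enc dec n y" for y
    unfolding decryption_error_def prob_split err_def K_def
    by (simp add: vimage_def flip: map_pmf_def)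
  then have err_le: "measure_pmf.expectation K (\<lambda>(sk, pk). err y sk pk) \<le> \<gamma>" for y
    using assms(3) by simp
  have bad: "measure_pmf.prob K bad \<le> a"
  proof -
    have "measure_pmf.prob K (- bad) \<ge> 1 - a"
      using learn by (simp add: dec_distribution_def K_def bad_def S_def vimage_def case_prod_unfold Compl_eq)
    then show ?thesis
      using measure_pmf.prob_compl[of bad K] by (simp add: Compl_eq_Diff_UNIV)
  qed
  have key: "(1 - acc True pk) / 2 + acc False pk / 2 \<le>
      indicator bad (sk, pk) + 2 * a + (real t + 1) * (err True sk pk / 2 + err False sk pk / 2)"
    if "(sk, pk) \<in> set_pmf K" for sk pk
  proof (cases "(sk, pk) \<in> bad")
    case True
    have "(1 - acc True pk) / 2 + acc False pk / 2 \<le> 1"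
    proof -
      have "0 \<le> acc True pk" "acc False pk \<le> 1" by (simp_all add: acc_def)
      then show ?thesis by (simp add: field_simps)
    qed
    also have "1 \<le> indicator bad (sk, pk) + 2 * a + (real t + 1) * (err True sk pk / 2 + err False sk pk / 2)"
      using True \<open>0 \<le> a\<close> by (simp add: err_def)
    finally show ?thesis .
  next
    case False
    define f where "f = dec_fun dec n sk"
    define Q where "Q = bind_pmf (bernoulli_pmf (1 / 2)) (\<lambda>b. map_pmf (\<lambda>x. (x, b)) (encrypt enc n pk b))"
    have enc_cube: "set_pmf (encrypt enc n pk y) \<subseteq> cube n" for y
      using cube that by (simp add: K_def)
    \<comment> \<open>For generated keys all ciphertexts have length \<open>n\<close>, so padding is
      the identity.\<close>
    have Q: "sim_source enc n pk = Q"
      unfolding sim_source_def Q_def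
    proof (intro bind_pmf_cong refl map_pmf_cong)
      fix b x assume "x \<in> set_pmf (encrypt enc n pk b)"
      with enc_cube[of b] show "(pad n x, b) = (x, b)"
        by (auto simp: cube_def pad_eq_self)
    qed
    have Q_cube: "set_pmf (map_pmf fst Q) \<subseteq> cube n"
      using enc_cube[THEN subsetD] by (auto simp: Q_def)
    have dec_err: "measure_pmf.prob Q {(x, b). f x \<noteq> b} = err True sk pk / 2 + err False sk pk / 2"
    proof -
      have "measure_pmf.prob (map_pmf (\<lambda>x. (x, b)) (encrypt enc n pk b)) {(x, b). f x \<noteq> b} = err b sk pk" for b
      proof -
        have "measure_pmf.prob (map_pmf (\<lambda>x. (x, b)) (encrypt enc n pk b)) {(x, b). f x \<noteq> b} =
            measure_pmf.prob (encrypt enc n pk b) {x. f x \<noteq> b}"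
          by (simp add: vimage_def)
        \<comment> \<open>All ciphertexts lie in the cube, where the restricted function
          \<open>dec_fun\<close> agrees with \<open>dec\<close>.\<close>
        also have "\<dots> = err b sk pk"
          unfolding err_def using enc_cube[of b]
          by (intro measure_pmf.finite_measure_eq_AE) (auto simp: AE_measure_pmf_iff f_def dec_fun_def)
        finally show ?thesis .
      qed
      then show ?thesis
        by (simp add: Q_def prob_bind_pmf)
    qed
    have "measure_pmf.prob (bind_pmf (map_pmf out_string (outcome Q A inp)) (\<lambda>h.
        map_pmf (\<lambda>(x, b). H h x \<noteq> b) Q)) {b. b} \<le>
        2 * a + (real t + 1) * (err True sk pk / 2 + err False sk pk / 2)"
    proof (rule hypothesis_error_bound)
      show "halts_within Q A inp t" "halts_within (EX_oracle f (map_pmf fst Q)) A inp t"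
        using Q_cube by (force intro!: t simp: EX_oracle_def)+
      \<comment> \<open>The distribution \<open>map_pmf fst Q\<close> depends on the public key, so
        the guarantee is used at a distribution chosen together with \<open>f\<close>.\<close>
      show "1 - a \<le> measure_pmf.prob (map_pmf out_string (outcome (EX_oracle f (map_pmf fst Q)) A inp))
          {h. measure_pmf.prob (map_pmf fst Q) {x. H h x \<noteq> f x} \<le> a}"
        using False Q_cube unfolding bad_def S_def f_def by blast
    qed (use dec_err \<open>0 \<le> a\<close> in auto)
    also have "measure_pmf.prob (bind_pmf (map_pmf out_string (outcome Q A inp)) (\<lambda>h.
        map_pmf (\<lambda>(x, b). H h x \<noteq> b) Q)) {b. b} = (1 - acc True pk) / 2 + acc False pk / 2"
      unfolding acc_def L_def Q unfolding Q_def by (rule guessing_probability)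
    finally show ?thesis using False by simp
  qed
  have "(1 - measure_pmf.expectation K (\<lambda>(sk, pk). acc True pk)) / 2 +
      measure_pmf.expectation K (\<lambda>(sk, pk). acc False pk) / 2 =
      measure_pmf.expectation K (\<lambda>(sk, pk). (1 - acc True pk) / 2 + acc False pk / 2)"
    using int(1)[of True] int(1)[of False] by (simp add: case_prod_unfold)
  also have "\<dots> \<le> measure_pmf.expectation K (\<lambda>(sk, pk). indicator bad (sk, pk) + 2 * a +
      (real t + 1) * (err True sk pk / 2 + err False sk pk / 2))"
  proof (rule expectation_le)
    show "integrable (measure_pmf K) (\<lambda>(sk, pk). (1 - acc True pk) / 2 + acc False pk / 2)"
      using int(1)[of True] int(1)[of False] by (simp add: case_prod_unfold)
    show "integrable (measure_pmf K) (\<lambda>(sk, pk). indicator bad (sk, pk) + 2 * a +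
        (real t + 1) * (err True sk pk / 2 + err False sk pk / 2))"
      using int(2)[of True] int(2)[of False] int_bad by (simp add: case_prod_unfold)
  qed (use key in auto)
  also have "\<dots> = measure_pmf.prob K bad + 2 * a + (real t + 1) *
      (measure_pmf.expectation K (\<lambda>(sk, pk). err True sk pk) / 2 +
       measure_pmf.expectation K (\<lambda>(sk, pk). err False sk pk) / 2)"
    using int(2)[of True] int(2)[of False] int_bad by (simp add: case_prod_unfold)
  also have "\<dots> \<le> a + 2 * a + (real t + 1) * (\<gamma> / 2 + \<gamma> / 2)"
    using bad err_le by (intro add_mono mult_left_mono divide_right_mono) auto
  finally show ?thesis
    by (simp add: acc field_simps)
qed

section \<open>The contradiction with security\<close>

theorem theorem3p6:
  fixes gen enc :: prog
    and dec :: "bool list \<Rightarrow> bool list \<Rightarrow> bool"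
    and \<epsilon> :: "nat \<Rightarrow> real"
    and \<Lambda> :: "nat \<Rightarrow> (bool list \<Rightarrow> bool) set"
    and \<mu> :: "nat \<Rightarrow> (bool list \<Rightarrow> bool) pmf"
  assumes "pke_scheme gen enc"
    and "secure gen enc"
    and "\<forall>n>0. \<forall>y. decryption_error gen enc dec n y \<le> \<epsilon> n"
    and "\<exists>w :: nat \<Rightarrow> real. filterlim w at_top sequentially \<and>
           (\<forall>\<^sub>F n in sequentially. \<epsilon> n \<le> 1 / real n powr w n)"
    and "\<forall>n>0. \<Lambda> n \<subseteq> cube n \<rightarrow>\<^sub>E UNIV"
    and "\<forall>n>0. \<mu> n = dec_distribution gen dec n"
    and "\<forall>n>0. \<forall>(sk, pk) \<in> set_pmf (keypair gen n). dec_fun dec n sk \<in> \<Lambda> n"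
  shows "\<not> distributionally_PAC_learnable \<Lambda> \<mu>"
proof
  assume "distributionally_PAC_learnable \<Lambda> \<mu>"
  then obtain A H where A: "efficient_learner A" and H: "polytime_evaluable H"
    and learn: "\<forall>n>0. \<forall>\<epsilon>>0. \<forall>\<delta>>0. \<forall>\<eta>>0.
         measure_pmf.prob (\<mu> n) {f \<in> \<Lambda> n. \<forall>\<rho>. set_pmf \<rho> \<subseteq> cube n \<longrightarrow>
           measure_pmf.prob (map_pmf out_string (outcome (EX_oracle f \<rho>) A (learner_input n \<epsilon> \<delta> \<eta>)))
             {h. measure_pmf.prob \<rho> {x. H h x \<noteq> f x} \<le> \<epsilon>} \<ge> 1 - \<delta>} \<ge> 1 - \<eta>"
    unfolding distributionally_PAC_learnable_def by (elim exE conjE) (rule that)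
  from H obtain c where c: "ppt 2 c"
    "\<And>h x. map_pmf out_bit (outcome no_oracle c [h, x]) = return_pmf (H h x)"
    by (auto simp: polytime_evaluable_def)
  \<comment> \<open>With accuracy \<open>a\<close> the advantage is at least \<open>1 - 6 a\<close> up to a negligible term.\<close>
  define a :: real where "a = 1 / 12"
  have inp: "learner_input n a a a = [unary n, unary 12, unary 12, unary 12]" for n
    by (simp add: learner_input_def a_def)
  obtain pa where pa: "\<And>n Q. 0 < n \<Longrightarrow> set_pmf Q \<subseteq> cube n \<times> UNIV \<Longrightarrow>
      halts_within Q A [unary n, unary 12, unary 12, unary 12] (poly pa n)"
  proof -
    from A obtain p where p: "\<forall>n>0. \<forall>\<epsilon>>0. \<forall>\<delta>>0. \<forall>\<eta>>0. \<forall>Q. set_pmf Q \<subseteq> cube n \<times> UNIV \<longrightarrow>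
        halts_within Q A (learner_input n \<epsilon> \<delta> \<eta>)
         (nat \<lfloor>poly p (real n + 1 / \<epsilon> + 1 / \<delta> + 1 / \<eta>)\<rfloor>)"
      unfolding efficient_learner_def by (elim exE) (rule that)
    \<comment> \<open>36 is the sum of the three inverse parameters 12.\<close>
    obtain q :: "nat poly" where q: "\<And>n. \<bar>poly p (real n + 36)\<bar> \<le> real (poly q n)"
      using abs_real_poly_le_nat_poly by blast
    have "halts_within Q A [unary n, unary 12, unary 12, unary 12] (poly q n)"
      if "0 < n" "set_pmf Q \<subseteq> cube n \<times> UNIV" for n Q
    proof (rule halts_within_mono)
      show "halts_within Q A [unary n, unary 12, unary 12, unary 12]
          (nat \<lfloor>poly p (real n + 1 / a + 1 / a + 1 / a)\<rfloor>)"
        unfolding inp[symmetric] by (rule p[rule_format]) (use that in \<open>auto simp: a_def\<close>)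
      have "real n + 1 / a + 1 / a + 1 / a = real n + 36"
        by (simp add: a_def)
      then show "nat \<lfloor>poly p (real n + 1 / a + 1 / a + 1 / a)\<rfloor> \<le> poly q n"
        using q[of n] by (simp only:) linarith
    qed
    then show ?thesis using that by blast
  qed
  have "ppt 3 enc"
    using assms(1) by (simp add: pke_scheme_def)
  have cube: "set_pmf (encrypt enc n pk y) \<subseteq> cube n"
    if "0 < n" "(sk, pk) \<in> set_pmf (keypair gen n)" for n sk pk y
  proof -
    have "\<forall>n>0. \<forall>(sk, pk) \<in> set_pmf (keypair gen n). \<forall>y. set_pmf (encrypt enc n pk y) \<subseteq> cube n"
      using assms(1) by (simp add: pke_scheme_def)
    with that have "case (sk, pk) of (sk, pk) \<Rightarrow> \<forall>y. set_pmf (encrypt enc n pk y) \<subseteq> cube n"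
      by (intro bspec[where x = "(sk, pk)"]) simp_all
    then show ?thesis by simp
  qed
  obtain D where D: "ppt 3 D"
    "\<And>n pk ct. 0 < n \<Longrightarrow> map_pmf out_bit (outcome no_oracle D [unary n, pk, ct]) =
       map_pmf (\<lambda>h. H h ct) (map_pmf out_string
         (outcome (sim_source enc n pk) A [unary n, unary 12, unary 12, unary 12]))"
    by (rule attacker_ppt[OF \<open>ppt 3 enc\<close> c pa, rotated 2]) (assumption | rule that)+
  have adv: "accept_prob gen enc D n True - accept_prob gen enc D n False \<ge>
      1 - 6 * a - 2 * (real (poly pa n) + 1) * \<epsilon> n" if n: "0 < n" for n
  proof (rule attacker_advantage)
    show "1 - a \<le> measure_pmf.prob (dec_distribution gen dec n) {f. \<forall>\<rho>. set_pmf \<rho> \<subseteq> cube n \<longrightarrow>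
        1 - a \<le> measure_pmf.prob (map_pmf out_string (outcome (EX_oracle f \<rho>) A
          [unary n, unary 12, unary 12, unary 12])) {h. measure_pmf.prob \<rho> {x. H h x \<noteq> f x} \<le> a}}"
    proof (rule order_trans)
      show "1 - a \<le> measure_pmf.prob (dec_distribution gen dec n)
          {f \<in> \<Lambda> n. \<forall>\<rho>. set_pmf \<rho> \<subseteq> cube n \<longrightarrow>
           measure_pmf.prob (map_pmf out_string (outcome (EX_oracle f \<rho>) A (learner_input n a a a)))
             {h. measure_pmf.prob \<rho> {x. H h x \<noteq> f x} \<le> a} \<ge> 1 - a}"
        using learn[rule_format, OF n, of a a a] assms(6) n by (simp add: a_def)
    qed (auto simp: inp intro!: measure_pmf.finite_measure_mono)
  qed (use n cube assms(3) pa D(2) in \<open>auto simp: a_def\<close>)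
  from assms(4) obtain w where w: "filterlim w at_top sequentially"
    "\<forall>\<^sub>F n in sequentially. \<epsilon> n \<le> 1 / real n powr w n" by blast
  have "\<forall>\<^sub>F n in sequentially.
      \<bar>accept_prob gen enc D n True - accept_prob gen enc D n False\<bar> < 1 / poly [:4:] (real n)"
    using assms(2)[unfolded secure_def, rule_format, OF D(1), of "[:4:]"] by simp
  moreover have "\<forall>\<^sub>F n in sequentially. real (poly (2 * (pa + 1)) n) * (1 / real n powr w n) \<le> 1 / 4"
    by (rule negligible_times_poly[OF w(1)]) simp
  moreover note w(2) eventually_gt_at_top[of "0 :: nat"]
  ultimately have "\<forall>\<^sub>F n :: nat in sequentially. False"
  proof eventually_elim
    \<comment> \<open>Security for the constant polynomial 4 puts the advantage below 1/4, whereas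
      1/2 minus an error term of at most 1/4 keeps it at 1/4 or above.\<close>
    case (elim n)
    have "2 * (real (poly pa n) + 1) * \<epsilon> n \<le> 2 * (real (poly pa n) + 1) * (1 / real n powr w n)"
      using elim(3) by (intro mult_left_mono) auto
    also have "\<dots> = real (poly (2 * (pa + 1)) n) * (1 / real n powr w n)"
      by simp
    also note elim(2)
    finally have "2 * (real (poly pa n) + 1) * \<epsilon> n \<le> 1 / 4" .
    moreover have "\<bar>accept_prob gen enc D n True - accept_prob gen enc D n False\<bar> < 1 / 4"
      using elim(1) by simp
    moreover have "1 - 6 * a = 1 / 2"
      by (simp add: a_def)
    ultimately show ?case
      using adv[OF elim(4)] by argo
  qed
  then show False by simp
qed

end
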